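(* Let $M \in \mathbb{C}^{n\times n}$ be an idempotent matrix ($M^2=M$) of rank $r$, let $s=n-r$, and let $$t=\operatorname{rank}(M)-\dim(\operatorname{null}(I-MM^H)).$$ Let $\sigma_1\ge\cdots\ge\sigma_r>0$ be the nonzero singular values of $M$, and let $\psi_j\in[0,\pi/2)$ be defined by $\cos\psi_j=\sigma_j^{-1}$ for $j=1,\dots,r$, so that $\frac{\pi}{2}>\psi_1\ge\cdots\ge\psi_t>\psi_{t+1}=\cdots=\psi_r=0$. Put $C=\operatorname{diag}(\cos\psi_1,\dots,\cos\psi_t)$ and $S=\operatorname{diag}(\sin\psi_1,\dots,\sin\psi_t)$. Then there exists a unitary matrix $\mathcal{U}\in\mathbb{C}^{n\times n}$ such that, for every diagonal sign matrix $E=\operatorname{diag}(\pm1,\dots,\pm1)\in\mathbb{R}^{t\times t}$, with $$\mathcal{S}=\begin{bmatrix} C^{-1}&&&\\ &I_{r-t}&&\\ &&0_{s-t}&\\ &&&0_t\end{bmatrix}\in\mathbb{R}^{n\times n},\qquad O=\begin{bmatrix} C&0&ES\\ 0&I_{n-2t}&0\\ S&0&-EC\end{bmatrix}\in\mathbb{R}^{n\times n},$$ the matrix $O$ is real orthogonal, $\mathcal{V}=\mathcal{U}O$ is unitary, and $$M=\mathcal{U}\,\mathcal{S}\,O^T\,\mathcal{U}^H=\mathcal{U}\,\mathcal{S}\,\mathcal{V}^H$$ is a singular value decomposition of $M$.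
   Context: $X^H$ denotes the conjugate transpose. $I_k$ and $0_k$ denote the $k\times k$ identity and zero matrices. A singular value decomposition of $M\in\mathbb{C}^{n\times n}$ is a factorization $M=U\Sigma V^H$ with $U,V$ unitary and $\Sigma$ diagonal with real nonnegative diagonal entries in decreasing (non-increasing) order. The nonzero singular values of an idempotent matrix are all at least $1$, so the angles $\psi_j$ are well defined, and $t\le\min\{r,s\}$. *)

theory Defs
  imports
    Complex_Main
    "Jordan_Normal_Form.Matrix_Kernel"
    "Jordan_Normal_Form.Gauss_Jordan_Elimination"
    "Jordan_Normal_Form.Schur_Decomposition"
    "Jordan_Normal_Form.DL_Rank"
begin

abbreviation cmat :: "real mat \<Rightarrow> complex mat" where
  "cmat A \<equiv> map_mat complex_of_real A"

definition unitary_matrix :: "nat \<Rightarrow> complex mat \<Rightarrow> bool" where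
  "unitary_matrix n U \<longleftrightarrow> U \<in> carrier_mat n n
     \<and> mat_adjoint U * U = 1\<^sub>m n \<and> U * mat_adjoint U = 1\<^sub>m n"

(* The library's orthogonal_mat only asks for pairwise orthogonal nonzero columns. *)
definition real_orthogonal_matrix :: "nat \<Rightarrow> real mat \<Rightarrow> bool" where
  "real_orthogonal_matrix n Q \<longleftrightarrow> Q \<in> carrier_mat n n
     \<and> transpose_mat Q * Q = 1\<^sub>m n \<and> Q * transpose_mat Q = 1\<^sub>m n"

definition is_svd :: "nat \<Rightarrow> complex mat \<Rightarrow> complex mat \<Rightarrow> real mat \<Rightarrow> complex mat \<Rightarrow> bool" where
  "is_svd n M U Sg V \<longleftrightarrow>
     unitary_matrix n U \<and> unitary_matrix n V
     \<and> Sg \<in> carrier_mat n n \<and> diagonal_mat Sg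
     \<and> (\<forall>i<n. 0 \<le> Sg $$ (i,i))
     \<and> (\<forall>i j. i \<le> j \<and> j < n \<longrightarrow> Sg $$ (j,j) \<le> Sg $$ (i,i))
     \<and> M = U * cmat Sg * mat_adjoint V"

(* The diagonal of Sg is the same in every singular value decomposition of M. *)
definition singular_values :: "nat \<Rightarrow> complex mat \<Rightarrow> real list" where
  "singular_values n M = (THE ss. \<exists>U Sg V. is_svd n M U Sg V \<and> ss = diag_mat Sg)"

definition nonzero_singular_values :: "nat \<Rightarrow> complex mat \<Rightarrow> real list" where
  "nonzero_singular_values n M = filter (\<lambda>x. x \<noteq> 0) (singular_values n M)"

definition sign_matrix :: "nat \<Rightarrow> real mat \<Rightarrow> bool" where
  "sign_matrix t E \<longleftrightarrow> E \<in> carrier_mat t t \<and> diagonal_mat E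
     \<and> (\<forall>i<t. E $$ (i,i) = 1 \<or> E $$ (i,i) = -1)"

definition append_cols :: "'a::zero mat \<Rightarrow> 'a mat \<Rightarrow> 'a mat" where
  "append_cols A B = four_block_mat A B (0\<^sub>m 0 (dim_col A)) (0\<^sub>m 0 (dim_col B))"

(* The block matrix with block rows (A11 A12 A13), (A21 A22 A23), (A31 A32 A33). *)
definition nine_block_mat ::
  "'a::zero mat \<Rightarrow> 'a mat \<Rightarrow> 'a mat \<Rightarrow> 'a mat \<Rightarrow> 'a mat \<Rightarrow> 'a mat \<Rightarrow> 'a mat \<Rightarrow> 'a mat \<Rightarrow> 'a mat \<Rightarrow> 'a mat"
where
  "nine_block_mat A11 A12 A13 A21 A22 A23 A31 A32 A33 =
     four_block_mat A11 (append_cols A12 A13)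
                    (A21 @\<^sub>r A31) (four_block_mat A22 A23 A32 A33)"

end

theory Submission
  imports Defs
begin

text \<open>Choose an orthonormal eigenbasis \<open>u\<^sub>i\<close> of \<open>M M\<^sup>H\<close> with decreasing eigenvalues
  \<open>\<lambda>\<^sub>i\<close>. Whenever \<open>\<lambda>\<^sub>i \<noteq> 0\<close> we have \<open>M u\<^sub>i = u\<^sub>i\<close>, and for two such indices
  \<open>g\<^sub>i = M\<^sup>H u\<^sub>i - u\<^sub>i\<close> is orthogonal to \<open>u\<^sub>j\<close>, with \<open>\<langle>g\<^sub>i, g\<^sub>j\<rangle> = (\<lambda>\<^sub>i - 1) \<delta>\<^sub>i\<^sub>j\<close>.
  Hence nonzero \<open>\<lambda>\<^sub>i\<close> are at least \<open>1\<close>. Normalising those \<open>g\<^sub>i\<close> with \<open>\<lambda>\<^sub>i > 1\<close> and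
  extending to an orthonormal basis gives the columns of \<open>\<U>\<close>; in this basis \<open>M\<close> maps the
  normalised \<open>g\<^sub>i\<close> to \<open>tan \<psi>\<^sub>i u\<^sub>i\<close>, fixes the \<open>u\<^sub>i\<close> with \<open>\<lambda>\<^sub>i \<noteq> 0\<close> and kills the remaining
  basis vectors. The product \<open>\<S> O\<^sup>T\<close> is exactly this matrix, for every choice of signs,
  because \<open>E\<close> occurs only in the last rows of \<open>O\<^sup>T\<close>, which \<open>\<S>\<close> annihilates.\<close>

section \<open>Adjoints and inner products\<close>

lemma mat_adjoint_carrier [simp]:
  "A \<in> carrier_mat n m \<Longrightarrow> mat_adjoint A \<in> carrier_mat m n"
  unfolding mat_adjoint_def by (auto simp: mat_of_rows_def)

lemma dim_mat_adjoint [simp]: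
  "dim_row (mat_adjoint A) = dim_col A" "dim_col (mat_adjoint A) = dim_row A"
  unfolding mat_adjoint_def by (auto simp: mat_of_rows_def)

lemma index_mat_adjoint [simp]:
  "i < dim_col A \<Longrightarrow> j < dim_row A \<Longrightarrow> mat_adjoint A $$ (i, j) = conjugate (A $$ (j, i))"
  unfolding mat_adjoint_def by (auto simp: mat_of_rows_def)

lemma mat_adjoint_adjoint [simp]: "mat_adjoint (mat_adjoint A) = A"
  by (rule eq_matI) auto

lemma mat_adjoint_mult:
  fixes A :: "'a :: {conjugatable_field} mat"
  assumes "A \<in> carrier_mat n m" "B \<in> carrier_mat m k"
  shows "mat_adjoint (A * B) = mat_adjoint B * mat_adjoint A"
  by (rule eq_matI)
    (use assms in \<open>auto simp: scalar_prod_def sum_conjugate conjugate_dist_mul ac_simps intro!: sum.cong\<close>)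

lemma mat_adjoint_cmat: "mat_adjoint (cmat A) = cmat (transpose_mat A)"
  by (rule eq_matI) auto

lemma mult_mat_vec_inner:
  fixes A :: "complex mat"
  assumes A: "A \<in> carrier_mat n m" and x: "x \<in> carrier_vec m" and y: "y \<in> carrier_vec n"
  shows "(A *\<^sub>v x) \<bullet>c y = x \<bullet>c (mat_adjoint A *\<^sub>v y)"
proof -
  have "(A *\<^sub>v x) \<bullet>c y = (\<Sum>i<n. \<Sum>j<m. A $$ (i,j) * x $ j * cnj (y $ i))"
    using A x y by (auto simp: scalar_prod_def sum_distrib_right atLeast0LessThan intro!: sum.cong)
  also have "\<dots> = (\<Sum>j<m. \<Sum>i<n. A $$ (i,j) * x $ j * cnj (y $ i))"
    by (rule sum.swap)
  also have "\<dots> = x \<bullet>c (mat_adjoint A *\<^sub>v y)"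
    using A x y by (auto simp: scalar_prod_def sum_distrib_left atLeast0LessThan ac_simps intro!: sum.cong)
  finally show ?thesis .
qed

lemma inner_swap:
  fixes x y :: "complex vec"
  assumes "x \<in> carrier_vec n" "y \<in> carrier_vec n"
  shows "y \<bullet>c x = cnj (x \<bullet>c y)"
  using assms by (auto simp: scalar_prod_def ac_simps)

lemma inner_smult_left:
  fixes x y :: "complex vec"
  assumes "x \<in> carrier_vec n" "y \<in> carrier_vec n"
  shows "(a \<cdot>\<^sub>v x) \<bullet>c y = a * (x \<bullet>c y)"
  using assms by (auto simp: scalar_prod_def ac_simps sum_distrib_left)

lemma inner_smult_right:
  fixes x y :: "complex vec"
  assumes "x \<in> carrier_vec n" "y \<in> carrier_vec n"
  shows "x \<bullet>c (a \<cdot>\<^sub>v y) = cnj a * (x \<bullet>c y)"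
  using assms by (auto simp: scalar_prod_def ac_simps sum_distrib_left)

lemma inner_diff_left:
  fixes x y z :: "complex vec"
  assumes "x \<in> carrier_vec n" "y \<in> carrier_vec n" "z \<in> carrier_vec n"
  shows "(x - y) \<bullet>c z = x \<bullet>c z - y \<bullet>c z"
  using assms by (auto simp: scalar_prod_def algebra_simps sum_subtractf)

lemma inner_diff_right:
  fixes x y z :: "complex vec"
  assumes "x \<in> carrier_vec n" "y \<in> carrier_vec n" "z \<in> carrier_vec n"
  shows "z \<bullet>c (x - y) = z \<bullet>c x - z \<bullet>c y"
  using assms by (auto simp: scalar_prod_def algebra_simps sum_subtractf)

text \<open>Exhibits a squared norm as an embedded nonnegative real. This is how the real
  inequalities on eigenvalues are extracted from complex scalar products further on.\<close>

lemma inner_self: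
  fixes x :: "complex vec"
  shows "x \<bullet>c x = complex_of_real (\<Sum>i<dim_vec x. (cmod (x $ i))\<^sup>2)"
  by (auto simp: scalar_prod_def complex_norm_square[symmetric] atLeast0LessThan
      simp del: of_real_power intro!: sum.cong)
    
lemma vec_normalize:
  fixes x :: "complex vec"
  assumes x: "x \<in> carrier_vec n" "x \<noteq> 0\<^sub>v n"
  obtains a where "(a \<cdot>\<^sub>v x) \<bullet>c (a \<cdot>\<^sub>v x) = 1"
proof -
  define N where "N = (\<Sum>i<dim_vec x. (cmod (x $ i))\<^sup>2)"
  have N: "x \<bullet>c x = of_real N"
    unfolding N_def by (rule inner_self)
  have "N \<noteq> 0" using N conjugate_square_eq_0_vec[OF x(1)] x(2) by auto
  moreover have "N \<ge> 0" unfolding N_def by (intro sum_nonneg) auto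
  ultimately have "N > 0" by simp
  let ?a = "complex_of_real (1 / sqrt N)"
  have "(?a \<cdot>\<^sub>v x) \<bullet>c (?a \<cdot>\<^sub>v x) = ?a * (cnj ?a * (x \<bullet>c x))"
    using x by (simp add: inner_smult_left[of _ n] inner_smult_right[of _ n])
  also have "\<dots> = complex_of_real (1 / sqrt N * (1 / sqrt N * N))"
    by (simp only: N complex_cnj_complex_of_real of_real_mult)
  also have "1 / sqrt N * (1 / sqrt N * N) = 1" using \<open>N > 0\<close> by (simp add: field_simps)
  finally show ?thesis by (intro that[of ?a]) simp
qed

section \<open>Orthonormal families\<close>

text \<open>Families are functions of which only the first \<open>k\<close> values matter, so that
  extending is a function update and permuting is a composition.\<close>

definition orthonormal :: "nat \<Rightarrow> nat \<Rightarrow> (nat \<Rightarrow> complex vec) \<Rightarrow> bool" where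
  "orthonormal n k u \<longleftrightarrow> (\<forall>i<k. u i \<in> carrier_vec n)
     \<and> (\<forall>i<k. \<forall>j<k. u i \<bullet>c u j = (if i = j then 1 else 0))"

lemma orthonormal_carrier: "orthonormal n k u \<Longrightarrow> i < k \<Longrightarrow> u i \<in> carrier_vec n"
  by (simp add: orthonormal_def)

lemma orthonormal_inner:
  "orthonormal n k u \<Longrightarrow> i < k \<Longrightarrow> j < k \<Longrightarrow> u i \<bullet>c u j = (if i = j then 1 else 0)"
  by (simp add: orthonormal_def)

lemma orthonormal_reindex:
  assumes "orthonormal n k u" "inj_on f {..<m}" "f ` {..<m} \<subseteq> {..<k}"
  shows "orthonormal n m (u \<circ> f)"
  using assms by (auto simp: orthonormal_def inj_on_def image_subset_iff)

definition cols_mat :: "nat \<Rightarrow> nat \<Rightarrow> (nat \<Rightarrow> 'a vec) \<Rightarrow> 'a mat" where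
  "cols_mat n k u = mat n k (\<lambda>(i, j). u j $ i)"

lemma cols_mat_carrier [simp]: "cols_mat n k u \<in> carrier_mat n k"
  by (simp add: cols_mat_def)

lemma col_cols_mat: "u j \<in> carrier_vec n \<Longrightarrow> j < k \<Longrightarrow> col (cols_mat n k u) j = u j"
  by (auto simp: cols_mat_def)

lemma adjoint_cols_mat_mult_vec:
  assumes "orthonormal n k u" "x \<in> carrier_vec n"
  shows "mat_adjoint (cols_mat n k u) *\<^sub>v x = vec k (\<lambda>i. x \<bullet>c u i)"
  using assms 
  by (auto simp: cols_mat_def scalar_prod_def orthonormal_def ac_simps intro!: eq_vecI sum.cong)

lemma orthonormal_cols_mat:
  assumes "orthonormal n k u"
  shows "mat_adjoint (cols_mat n k u) * cols_mat n k u = 1\<^sub>m k"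
proof (rule eq_matI)
  fix i j assume ij: "i < dim_row (1\<^sub>m k :: complex mat)" "j < dim_col (1\<^sub>m k :: complex mat)"
  have "(mat_adjoint (cols_mat n k u) * cols_mat n k u) $$ (i, j)
      = (mat_adjoint (cols_mat n k u) *\<^sub>v col (cols_mat n k u) j) $ i"
    using ij by (simp add: cols_mat_def)
  also have "\<dots> = u j \<bullet>c u i"
    using ij assms by (simp add: col_cols_mat orthonormal_carrier adjoint_cols_mat_mult_vec)
  finally show "(mat_adjoint (cols_mat n k u) * cols_mat n k u) $$ (i, j) = 1\<^sub>m k $$ (i, j)"
    using ij assms by (auto simp: orthonormal_inner)
qed (auto simp: cols_mat_def)

lemma orthonormal_unitary:
  assumes "orthonormal n n u"
  shows "unitary_matrix n (cols_mat n n u)"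
  unfolding unitary_matrix_def
  using orthonormal_cols_mat[OF assms]
    mat_mult_left_right_inverse[OF mat_adjoint_carrier[OF cols_mat_carrier] cols_mat_carrier]
  by simp

text \<open>A unitary \<open>?U\<close> recovers a vector from its coordinates
  \<open>mat_adjoint ?U *\<^sub>v x\<close>, so vector identities can be tested against a
  basis.\<close>

lemma orthonormal_basis_vec_eqI:
  assumes u: "orthonormal n n u" and x: "x \<in> carrier_vec n" and y: "y \<in> carrier_vec n"
    and eq: "\<And>i. i < n \<Longrightarrow> x \<bullet>c u i = y \<bullet>c u i"
  shows "x = y"
proof -
  let ?U = "cols_mat n n u"
  have inv: "z = ?U *\<^sub>v (mat_adjoint ?U *\<^sub>v z)" if "z \<in> carrier_vec n" for z
    using orthonormal_unitary[OF u] that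
    by (simp add: unitary_matrix_def assoc_mult_mat_vec[symmetric, of _ n n _ n])
  have "mat_adjoint ?U *\<^sub>v x = mat_adjoint ?U *\<^sub>v y"
    using x y eq by (auto simp: adjoint_cols_mat_mult_vec[OF u])
  then show ?thesis using inv[OF x] inv[OF y] by simp
qed

text \<open>If \<open>n < k\<close>, zero rows pad the column matrix to a square \<open>W\<close>
  without changing its Gram matrix. Then \<open>W\<close> has a left inverse, hence a right inverse,
  although its row \<open>n\<close> is zero.\<close>

lemma orthonormal_le:
  assumes u: "orthonormal n k u"
  shows "k \<le> n"
proof (rule ccontr)
  assume "\<not> k \<le> n"
  then have nk: "n < k" by simp
  define W where "W = mat k k (\<lambda>(i, j). if i < n then u j $ i else 0)"
  have W: "W \<in> carrier_mat k k" by (simp add: W_def)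
  have "mat_adjoint W * W = mat_adjoint (cols_mat n k u) * cols_mat n k u"
  proof (rule eq_matI)
    fix i j assume ij: "i < dim_row (mat_adjoint (cols_mat n k u) * cols_mat n k u)"
      "j < dim_col (mat_adjoint (cols_mat n k u) * cols_mat n k u)"
    have "(\<Sum>ia = 0..<k. cnj (if ia < n then u i $ ia else 0) * (if ia < n then u j $ ia else 0))
       = (\<Sum>ia = 0..<n. cnj (u i $ ia) * u j $ ia)"
      using nk by (intro sum.mono_neutral_cong_right) auto
    then show "(mat_adjoint W * W) $$ (i, j)
       = (mat_adjoint (cols_mat n k u) * cols_mat n k u) $$ (i, j)"
      using ij by (simp add: W_def cols_mat_def scalar_prod_def)
  qed (auto simp: W_def cols_mat_def)
  then have "W * mat_adjoint W = 1\<^sub>m k"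
    using orthonormal_cols_mat[OF u] mat_mult_left_right_inverse[of "mat_adjoint W" k W] W by simp
  then have "(W * mat_adjoint W) $$ (n, n) = 1" using nk by simp
  moreover have "(W * mat_adjoint W) $$ (n, n) = 0" using nk by (simp add: W_def scalar_prod_def)
  ultimately show False by simp
qed

text \<open>The square matrix with rows \<open>cnj (u i)\<close>, filled up with zero rows, is
  singular because row \<open>k\<close> is zero. A nonzero kernel vector is orthogonal to every
  \<open>u i\<close> and only has to be normalised.\<close>

lemma orthonormal_extend_one:
  assumes u: "orthonormal n k u" and k: "k < n"
  obtains w where "orthonormal n (Suc k) (u(k := w))"
proof -
  define W where "W = mat n n (\<lambda>(i, j). if i < k then cnj (u i $ j) else 0)"
  have W: "W \<in> carrier_mat n n" by (simp add: W_def)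
  have "det W = 0"
  proof (rule ccontr)
    assume "det W \<noteq> 0"
    then obtain B where B: "B \<in> carrier_mat n n" "W * B = 1\<^sub>m n"
      using det_non_zero_imp_unit[OF W, of "TYPE(complex)"] 
      by (auto simp: Units_def ring_mat_def)
    have "(W * B) $$ (k, k) = 1" using k B by simp
    moreover have "(W * B) $$ (k, k) = 0" using k W B(1)
      by (simp add: scalar_prod_def) (simp add: W_def)
    ultimately show False by simp
  qed
  then obtain v where v: "v \<in> carrier_vec n" "v \<noteq> 0\<^sub>v n" "W *\<^sub>v v = 0\<^sub>v n"
    using det_0_iff_vec_prod_zero[OF W] by auto
  have orth: "v \<bullet>c u i = 0" if i: "i < k" for i
  proof -
    have "(W *\<^sub>v v) $ i = v \<bullet>c u i"
      using i k v(1) orthonormal_carrier[OF u i]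
      by (auto simp: W_def scalar_prod_def ac_simps intro!: sum.cong)
    then show ?thesis using v i k by simp
  qed
  from vec_normalize[OF v(1,2)] obtain a where a: "(a \<cdot>\<^sub>v v) \<bullet>c (a \<cdot>\<^sub>v v) = 1" by blast
  have 1: "(a \<cdot>\<^sub>v v) \<bullet>c u i = 0" if "i < k" for i
    using orth[OF that] u v that by (simp add: inner_smult_left[of _ n] orthonormal_carrier)
  have 2: "u i \<bullet>c (a \<cdot>\<^sub>v v) = 0" if "i < k" for i
    using 1[OF that] inner_swap[of "a \<cdot>\<^sub>v v" n "u i"] u v that by (simp add: orthonormal_carrier)
  have "orthonormal n (Suc k) (u(k := a \<cdot>\<^sub>v v))"
    using u v a 1 2 by (auto simp: orthonormal_def less_Suc_eq)
  then show ?thesis by (rule that)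
qed

lemma orthonormal_extend:
  assumes u: "orthonormal n k u"
  obtains w where "orthonormal n n w" "\<And>i. i < k \<Longrightarrow> w i = u i"
proof -
  have "\<exists>w. orthonormal n (k + m) w \<and> (\<forall>i<k. w i = u i)" if "k + m \<le> n" for m
    using that
  proof (induction m)
    case 0
    then show ?case using u by auto
  next
    case (Suc m)
    then obtain w where w: "orthonormal n (k + m) w" "\<forall>i<k. w i = u i" by auto
    from orthonormal_extend_one[OF w(1)] Suc.prems
    obtain z where "orthonormal n (Suc (k + m)) (w(k + m := z))" by auto
    with w(2) show ?case by (intro exI[of _ "w(k + m := z)"]) (simp add: fun_upd_def)
  qed
  from this[of "n - k"] orthonormal_le[OF u] show ?thesis using that by auto
qed

section \<open>Eigenbases of Hermitian matrices\<close>

lemma eigenvector_exists: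
  fixes A :: "complex mat"
  assumes A: "A \<in> carrier_mat n n" and n: "n > 0"
  obtains v e where "v \<in> carrier_vec n" "v \<noteq> 0\<^sub>v n" "A *\<^sub>v v = e \<cdot>\<^sub>v v"
proof -
  from char_poly_factorized[OF A] obtain as
    where as: "char_poly A = (\<Prod>a\<leftarrow>as. [:- a, 1:])" "length as = n" by auto
  from as n obtain e es where "as = e # es" by (cases as) auto
  then have "poly (char_poly A) e = 0" using as by simp
  then have "eigenvalue A e" by (simp add: eigenvalue_root_char_poly[OF A])
  then show ?thesis using that A by (auto simp: eigenvalue_def eigenvector_def)
qed

lemma hermitian_eigenvalue_real:
  fixes A :: "complex mat"
  assumes A: "A \<in> carrier_mat n n" "mat_adjoint A = A"
    and v: "v \<in> carrier_vec n" "v \<noteq> 0\<^sub>v n" "A *\<^sub>v v = e \<cdot>\<^sub>v v"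
  shows "e \<in> \<real>"
proof -
  have "e * (v \<bullet>c v) = (A *\<^sub>v v) \<bullet>c v"
    using v by (simp add: inner_smult_left[of _ n])
  also have "\<dots> = v \<bullet>c (A *\<^sub>v v)"
    using mult_mat_vec_inner[OF A(1) v(1) v(1)] A(2) by simp
  also have "\<dots> = cnj e * (v \<bullet>c v)"
    using v by (simp add: inner_smult_right[of _ n])
  finally have "e = cnj e" using v conjugate_square_eq_0_vec[OF v(1)] by simp
  then show ?thesis by (simp add: Reals_cnj_iff)
qed

text \<open>The new eigenvector is found by compressing \<open>A\<close> to the orthogonal complement of the
  given ones, which \<open>A\<close> leaves invariant.\<close>

lemma hermitian_eigenvectors_extend:
  fixes A :: "complex mat"
  assumes A: "A \<in> carrier_mat n n" "mat_adjoint A = A"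
    and u: "orthonormal n k u" and k: "k < n"
    and ev: "\<And>i. i < k \<Longrightarrow> A *\<^sub>v u i = complex_of_real (l i) \<cdot>\<^sub>v u i"
  obtains y e where "orthonormal n (Suc k) (u(k := y))" "A *\<^sub>v y = complex_of_real e \<cdot>\<^sub>v y"
proof -
  obtain w where w: "orthonormal n n w" "\<And>i. i < k \<Longrightarrow> w i = u i"
    using orthonormal_extend[OF u] by blast
  define z where "z = (\<lambda>i. w (k + i))"
  have z: "orthonormal n (n - k) z"
    unfolding z_def using w(1) by (auto simp: orthonormal_def)
  define Z where "Z = cols_mat n (n - k) z"
  have Z: "Z \<in> carrier_mat n (n - k)" by (simp add: Z_def)
  have ZZ: "mat_adjoint Z * Z = 1\<^sub>m (n - k)"
    unfolding Z_def by (rule orthonormal_cols_mat[OF z])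
  have Zx: "mat_adjoint Z *\<^sub>v x = vec (n - k) (\<lambda>i. x \<bullet>c z i)" if "x \<in> carrier_vec n" for x
    unfolding Z_def by (rule adjoint_cols_mat_mult_vec[OF z that])
  obtain v e where v: "v \<in> carrier_vec (n - k)" "v \<noteq> 0\<^sub>v (n - k)"
    "(mat_adjoint Z * (A * Z)) *\<^sub>v v = e \<cdot>\<^sub>v v"
  proof -
    note mult_carrier_mat[OF mat_adjoint_carrier[OF Z] mult_carrier_mat[OF A(1) Z]]
    from eigenvector_exists[OF this] k that show ?thesis by auto
  qed
  define y where "y = Z *\<^sub>v v"
  have y: "y \<in> carrier_vec n" using Z v by (simp add: y_def)
  have Zy: "mat_adjoint Z *\<^sub>v y = v"
    unfolding y_def using Z v ZZ by (simp add: assoc_mult_mat_vec[symmetric, of _ "n-k" n _ "n-k"])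
  have y0: "y \<noteq> 0\<^sub>v n" using Zy v Z by auto
  have yu: "y \<bullet>c u i = 0" if i: "i < k" for i
  proof -
    have ui: "u i \<in> carrier_vec n" using u i by (rule orthonormal_carrier)
    have "mat_adjoint Z *\<^sub>v u i = 0\<^sub>v (n - k)"
    proof (rule eq_vecI)
      fix j assume "j < dim_vec (0\<^sub>v (n - k) :: complex vec)"
      then have "w i \<bullet>c w (k + j) = 0"
        using w(1) i k by (subst orthonormal_inner[OF w(1)]) auto
      then show "(mat_adjoint Z *\<^sub>v u i) $ j = 0\<^sub>v (n - k) $ j"
        using \<open>j < _\<close> Zx[OF ui] w(2)[OF i] by (simp add: z_def)
    qed (use Z in auto)
    then show ?thesis
      using mult_mat_vec_inner[OF Z v(1) ui] v by (simp add: y_def)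
  qed
  \<comment> \<open>Tested against the basis \<open>w\<close>. Against \<open>u i\<close> both sides
    vanish, since \<open>A\<close> is Hermitian and only rescales \<open>u i\<close>; against the
    vectors \<open>z i\<close> the identity is the eigenvalue equation of the compressed
    matrix.\<close>
  have Ay: "A *\<^sub>v y = e \<cdot>\<^sub>v y"
  proof (rule orthonormal_basis_vec_eqI[OF w(1)])
    fix i assume i: "i < n"
    show "(A *\<^sub>v y) \<bullet>c w i = (e \<cdot>\<^sub>v y) \<bullet>c w i"
    proof (cases "i < k")
      case True
      then have ui: "u i \<in> carrier_vec n" using orthonormal_carrier[OF u] by simp
      have "(A *\<^sub>v y) \<bullet>c u i = y \<bullet>c (A *\<^sub>v u i)"
        using mult_mat_vec_inner[OF A(1) y ui] A(2) by simp
      also have "\<dots> = 0"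
        using yu True ui y by (simp add: ev inner_smult_right[of _ n])
      finally show ?thesis
        using w(2)[OF True] yu[OF True] y ui by (simp add: inner_smult_left[of _ n])
    next
      case False
      have "mat_adjoint Z *\<^sub>v (A *\<^sub>v y) = e \<cdot>\<^sub>v v"
        using v(3) assoc_mult_mat_vec[OF mat_adjoint_carrier[OF Z] mult_carrier_mat[OF A(1) Z] v(1)]
          assoc_mult_mat_vec[OF A(1) Z v(1)] by (simp only: y_def)
      also have "\<dots> = mat_adjoint Z *\<^sub>v (e \<cdot>\<^sub>v y)"
        using Zy mult_mat_vec[OF mat_adjoint_carrier[OF Z] y, of e] by simp
      finally have "vec (n - k) (\<lambda>i. (A *\<^sub>v y) \<bullet>c z i) = vec (n - k) (\<lambda>i. (e \<cdot>\<^sub>v y) \<bullet>c z i)"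
        using Zx y A by simp
      then have "vec (n - k) (\<lambda>i. (A *\<^sub>v y) \<bullet>c z i) $ (i - k) = vec (n - k) (\<lambda>i. (e \<cdot>\<^sub>v y) \<bullet>c z i) $ (i - k)"
        by simp
      moreover have "k + (i - k) = i" using False by simp
      ultimately show ?thesis using False i by (simp add: z_def)
    qed
  qed (use A y in auto)
  have "e \<in> \<real>" by (rule hermitian_eigenvalue_real[OF A y y0 Ay])
  then obtain e' where e': "e = of_real e'" by (auto elim: Reals_cases)
  from vec_normalize[OF y y0] obtain a where a: "(a \<cdot>\<^sub>v y) \<bullet>c (a \<cdot>\<^sub>v y) = 1" by blast
  have 1: "(a \<cdot>\<^sub>v y) \<bullet>c u i = 0" if "i < k" for i
    using yu[OF that] u y that by (simp add: inner_smult_left[of _ n] orthonormal_carrier)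
  have 2: "u i \<bullet>c (a \<cdot>\<^sub>v y) = 0" if "i < k" for i
    using 1[OF that] inner_swap[of "a \<cdot>\<^sub>v y" n "u i"] u y that by (simp add: orthonormal_carrier)
  have "orthonormal n (Suc k) (u(k := a \<cdot>\<^sub>v y))"
    using u y a 1 2 by (auto simp: orthonormal_def less_Suc_eq)
  moreover have "A *\<^sub>v (a \<cdot>\<^sub>v y) = of_real e' \<cdot>\<^sub>v (a \<cdot>\<^sub>v y)"
    using A y Ay by (simp add: mult_mat_vec[of _ n n] smult_smult_assoc mult.commute e')
  ultimately show ?thesis by (rule that)
qed

lemma decreasing_reindex:
  fixes l :: "nat \<Rightarrow> real"
  obtains f where "bij_betw f {..<n} {..<n}" "\<And>i j. i \<le> j \<Longrightarrow> j < n \<Longrightarrow> l (f j) \<le> l (f i)"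
proof -
  define xs where "xs = sort_key (\<lambda>i. - l i) [0..<n]"
  have len: "length xs = n" and set: "set xs = {..<n}" and dist: "distinct xs"
    by (auto simp: xs_def)
  have sorted: "sorted (map (\<lambda>i. - l i) xs)" by (simp add: xs_def)
  have "bij_betw (\<lambda>i. xs ! i) {..<n} {..<n}"
    using bij_betw_nth[OF dist] len set by auto
  moreover have "l (xs ! j) \<le> l (xs ! i)" if "i \<le> j" "j < n" for i j
    using sorted_nth_mono[OF sorted, of i j] that len by simp
  ultimately show ?thesis by (rule that)
qed

text \<open>Induction on the number of eigenvectors already found, starting from the empty family.
  They arise in no particular order, so sorting is left to a final permutation.\<close>

theorem hermitian_eigenbasis:
  fixes A :: "complex mat"
  assumes A: "A \<in> carrier_mat n n" "mat_adjoint A = A"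
  obtains u l where "orthonormal n n u"
    "\<And>i. i < n \<Longrightarrow> A *\<^sub>v u i = complex_of_real (l i) \<cdot>\<^sub>v u i"
    "\<And>i j. i \<le> j \<Longrightarrow> j < n \<Longrightarrow> l j \<le> l i"
proof -
  have "\<exists>u l. orthonormal n k u \<and> (\<forall>i<k. A *\<^sub>v u i = complex_of_real (l i) \<cdot>\<^sub>v u i)" if "k \<le> n" for k
    using that
  proof (induction k)
    case 0
    then show ?case by (auto simp: orthonormal_def)
  next
    case (Suc k)
    then obtain u l where u: "orthonormal n k u" "\<forall>i<k. A *\<^sub>v u i = complex_of_real (l i) \<cdot>\<^sub>v u i"
      by auto
    obtain y e where y: "orthonormal n (Suc k) (u(k := y))" "A *\<^sub>v y = complex_of_real e \<cdot>\<^sub>v y"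
      using hermitian_eigenvectors_extend[OF A u(1), of l] Suc.prems u(2) by auto
    then show ?case
      using u(2) by (intro exI[of _ "u(k := y)"] exI[of _ "l(k := e)"]) (auto simp: less_Suc_eq fun_upd_def)
  qed
  then obtain u l where u: "orthonormal n n u" 
    "\<And>i. i < n \<Longrightarrow> A *\<^sub>v u i = complex_of_real (l i) \<cdot>\<^sub>v u i" by blast
  obtain f where f: "bij_betw f {..<n} {..<n}" "\<And>i j. i \<le> j \<Longrightarrow> j < n \<Longrightarrow> l (f j) \<le> l (f i)"
    using decreasing_reindex[of n l] by blast
  have "orthonormal n n (u \<circ> f)"
    using f(1) by (intro orthonormal_reindex[OF u(1)]) (auto simp: bij_betw_def)
  moreover have "f i < n" if "i < n" for i using f(1) that by (auto simp: bij_betw_def)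
  ultimately show ?thesis using u(2) f(2) by (intro that[of "u \<circ> f" "l \<circ> f"]) auto
qed

section \<open>Kernel dimensions, uniqueness of singular values, and rank\<close>

lemma kernel_dim_zero_one_by_one: "kernel_dim (0\<^sub>m 1 1 :: 'a :: field mat) = 1"
proof -
  interpret K: kernel 1 1 "0\<^sub>m 1 1 :: 'a mat" by unfold_locales auto
  have "mat_kernel (0\<^sub>m 1 1 :: 'a mat) = carrier_vec 1"
    by (auto simp: mat_kernel_def)
  then have "kernel_dim (0\<^sub>m 1 1 :: 'a mat) = vectorspace.dim class_ring (module_vec TYPE('a) 1)"
    by (simp add: kernel_dim_def module_vec_def del: One_nat_def)
  then show ?thesis by (simp add: vec_space.dim_is_n)
qed

text \<open>The last diagonal entry is split off as a one-by-one block. Kernel dimensions add up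
  over diagonal blocks, and such a block contributes 1 exactly when it is zero.\<close>

lemma kernel_dim_mat_diag:
  fixes f :: "nat \<Rightarrow> 'a :: field"
  shows "kernel_dim (mat_diag n f) = card {i. i < n \<and> f i = 0}"
proof (induction n)
  case 0
  have "kernel.dim 0 (1\<^sub>m 0 :: 'a mat) = 0" by (rule kernel_one_mat(1))
  moreover have "mat_diag 0 f = 1\<^sub>m 0" by (rule eq_matI) (auto simp: mat_diag_def)
  ultimately show ?case by (simp add: kernel_dim_def)
next
  case (Suc n)
  let ?D = "mat_diag 1 (\<lambda>_. f n)"
  have eq: "mat_diag (Suc n) f = four_block_mat (mat_diag n f) (0\<^sub>m n 1) (0\<^sub>m 1 n) ?D"
    by (rule eq_matI) (auto simp: mat_diag_def less_Suc_eq)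
  have one: "kernel_dim ?D = (if f n = 0 then 1 else 0)"
  proof (cases "f n = 0")
    case True
    then have "?D = 0\<^sub>m 1 1" by (auto simp: mat_diag_def)
    then show ?thesis using True kernel_dim_zero_one_by_one by simp
  next
    case False
    have "kernel.dim 1 ?D = 0"
      by (rule kernel_upper_triangular(1)) (use False in \<open>auto simp: mat_diag_def diag_mat_def\<close>)
    then show ?thesis using False by (simp add: kernel_dim_def mat_diag_def)
  qed
  have "kernel_dim (mat_diag (Suc n) f) = kernel_dim (mat_diag n f) + kernel_dim ?D"
    using kernel_four_block_0_mat[OF eq mat_diag_dim mat_diag_dim]
    by (simp add: kernel_dim_def mat_diag_def)
  also have "\<dots> = card {i. i < n \<and> f i = 0} + (if f n = 0 then 1 else 0)"
    using Suc one by simp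
  also have "{i. i < Suc n \<and> f i = 0} = {i. i < n \<and> f i = 0} \<union> (if f n = 0 then {n} else {})"
    by (auto simp: less_Suc_eq)
  then have "card {i. i < n \<and> f i = 0} + (if f n = 0 then 1 else 0) = card {i. i < Suc n \<and> f i = 0}"
    by auto
  finally show ?case .
qed

section \<open>Eigenvalue multiplicities under unitary conjugation\<close>

lemma unitary_matrixD:
  assumes "unitary_matrix n U"
  shows "U \<in> carrier_mat n n" "mat_adjoint U \<in> carrier_mat n n"
    "mat_adjoint U * U = 1\<^sub>m n" "U * mat_adjoint U = 1\<^sub>m n"
  using assms by (auto simp: unitary_matrix_def)

lemma kernel_dim_unitary_conj:
  assumes U: "unitary_matrix n U" and D: "D \<in> carrier_mat n n"
  shows "kernel_dim (U * D * mat_adjoint U) = kernel_dim D"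
proof -
  note U' = unitary_matrixD[OF U]
  have "similar_mat_wit (U * D * mat_adjoint U) D U (mat_adjoint U)"
    by (rule similar_mat_witI[of _ _ n]) (use U' D in auto)
  then have "kernel.dim n (U * D * mat_adjoint U) = kernel.dim n D"
    by (rule similar_mat_wit_kernel_dim[rotated]) (use U' D in auto)
  moreover have "dim_col (U * D * mat_adjoint U) = n" "dim_col D = n" using U' D by auto
  ultimately show ?thesis by (simp only: kernel_dim_def)
qed

text \<open>Conjugation by \<open>U\<close> carries the shifted matrix to the diagonal matrix with
  entries \<open>x - d i\<close>. The left side does not mention the diagonalisation, which gives
  uniqueness of singular values as well as the dimension of the null space that defines
  \<open>t\<close>.\<close>

lemma kernel_dim_shift_unitary_diag:
  assumes U: "unitary_matrix n U" and G: "G = U * mat_diag n d * mat_adjoint U"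
  shows "kernel_dim (x \<cdot>\<^sub>m 1\<^sub>m n - G) = card {i. i < n \<and> d i = x}"
proof -
  note U' = unitary_matrixD[OF U]
  let ?D = "mat_diag n (\<lambda>i. x - d i)"
  have D: "?D = x \<cdot>\<^sub>m 1\<^sub>m n - mat_diag n d"
    by (rule eq_matI) (auto simp: mat_diag_def)
  have "U * ?D * mat_adjoint U = U * (x \<cdot>\<^sub>m 1\<^sub>m n) * mat_adjoint U - G"
    unfolding D G using U'
    by (simp add: mult_minus_distrib_mat[of _ n n _ n] minus_mult_distrib_mat[of _ n n _ _ n])
  also have "U * (x \<cdot>\<^sub>m 1\<^sub>m n) * mat_adjoint U = x \<cdot>\<^sub>m 1\<^sub>m n"
    using U' by (simp add: mult_smult_distrib[of _ n n _ n] mult_smult_assoc_mat[of _ n n _ n])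
  finally have "kernel_dim (x \<cdot>\<^sub>m 1\<^sub>m n - G) = kernel_dim ?D"
    using kernel_dim_unitary_conj[OF U, of ?D] by simp
  then show ?thesis by (auto simp: kernel_dim_mat_diag intro!: arg_cong[where f = card])
qed

section \<open>Uniqueness of the singular values\<close>

lemma is_svd_gram:
  assumes svd: "is_svd n M U Sg V"
  shows "M * mat_adjoint M
    = U * mat_diag n (\<lambda>i. complex_of_real ((Sg $$ (i, i))\<^sup>2)) * mat_adjoint U"
proof -
  from svd have U: "unitary_matrix n U" and V: "unitary_matrix n V"
    and Sg: "Sg \<in> carrier_mat n n" "diagonal_mat Sg"
    and M: "M = U * cmat Sg * mat_adjoint V"
    by (auto simp: is_svd_def)
  note U' = unitary_matrixD[OF U] and V' = unitary_matrixD[OF V]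
  define D where "D = mat_diag n (\<lambda>i. complex_of_real (Sg $$ (i, i)))"
  have D: "D \<in> carrier_mat n n" by (simp add: D_def)
  have "cmat Sg = D"
    using Sg by (intro eq_matI) (auto simp: D_def mat_diag_def diagonal_mat_def)
  moreover have "mat_adjoint D = D"
    by (rule eq_matI) (auto simp: D_def mat_diag_def)
  ultimately have Ma: "mat_adjoint M = V * (D * mat_adjoint U)"
    unfolding M using U' V' D
    by (simp add: mat_adjoint_mult[of _ n n _ n])
  have VVx: "mat_adjoint V * (V * X) = X" if "X \<in> carrier_mat n n" for X
    using V' that by (simp add: assoc_mult_mat[symmetric, of _ n n _ n _ n])
  have "M * mat_adjoint M = U * (D * (mat_adjoint V * (V * (D * mat_adjoint U))))"
    unfolding Ma unfolding M \<open>cmat Sg = D\<close> using U' V' D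
    by (simp add: assoc_mult_mat[of _ n n _ n _ n])
  also have "\<dots> = U * (D * D) * mat_adjoint U"
    by (subst VVx[OF mult_carrier_mat[OF D U'(2)]])
      (use U' D in \<open>simp add: assoc_mult_mat[of _ n n _ n _ n]\<close>)
  also have "D * D = mat_diag n (\<lambda>i. complex_of_real ((Sg $$ (i, i))\<^sup>2))"
    by (simp add: D_def power2_eq_square)
  finally show ?thesis .
qed

text \<open>The right side depends on \<open>M\<close> alone, so all decompositions share one
  multiset of diagonal entries. Squaring is injective on nonnegative reals, which permits passing
  from the entries to the eigenvalues of \<open>M * mat_adjoint M\<close>; negative values never
  occur on the diagonal.\<close>

lemma is_svd_count:
  assumes svd: "is_svd n M U Sg V"
  shows "count (mset (diag_mat Sg)) x
    = (if 0 \<le> x then kernel_dim (complex_of_real (x\<^sup>2) \<cdot>\<^sub>m 1\<^sub>m n - M * mat_adjoint M) else 0)"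
proof -
  from svd have U: "unitary_matrix n U"
    and Sg: "Sg \<in> carrier_mat n n" "\<And>i. i < n \<Longrightarrow> 0 \<le> Sg $$ (i, i)"
    by (auto simp: is_svd_def)
  have "count (mset (diag_mat Sg)) x = length (filter (\<lambda>y. x = y) (diag_mat Sg))"
    by (simp add: count_mset count_list_eq_length_filter)
  also have "\<dots> = card {i. i < n \<and> Sg $$ (i, i) = x}"
    using Sg(1) by (auto simp: length_filter_conv_card diag_mat_def intro!: arg_cong[where f = card])
  also have "\<dots> = (if 0 \<le> x then
      card {i. i < n \<and> complex_of_real ((Sg $$ (i, i))\<^sup>2) = complex_of_real (x\<^sup>2)} else 0)"
    using Sg(2) by (force simp: power2_eq_iff_nonneg simp del: of_real_power intro!: arg_cong[where f = card])
  finally show ?thesis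
    unfolding kernel_dim_shift_unitary_diag[OF U is_svd_gram[OF svd]] .
qed

lemma is_svd_decreasing:
  assumes "is_svd n M U Sg V"
  shows "sorted (rev (diag_mat Sg))"
  using assms by (auto simp: is_svd_def diag_mat_def sorted_rev_iff_nth_mono)

text \<open>Two decreasing lists with the same multiset coincide, so the definite description has
  exactly one candidate. The lists are reversed because \<open>sorted\<close> means
  ascending.\<close>

lemma singular_values_eq:
  assumes svd: "is_svd n M U Sg V"
  shows "singular_values n M = diag_mat Sg"
  unfolding singular_values_def
proof (rule the_equality)
  show "\<exists>U Sg' V. is_svd n M U Sg' V \<and> diag_mat Sg = diag_mat Sg'" using svd by blast
next
  fix ss assume "\<exists>U Sg V. is_svd n M U Sg V \<and> ss = diag_mat Sg"
  then obtain U' Sg' V' where svd': "is_svd n M U' Sg' V'" and ss: "ss = diag_mat Sg'" by blast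
  have "mset (diag_mat Sg') = mset (diag_mat Sg)"
    by (rule multiset_eqI) (simp only: is_svd_count[OF svd] is_svd_count[OF svd'])
  then have "sort (rev (diag_mat Sg)) = rev ss"
    unfolding ss by (intro properties_for_sort) (simp_all add: is_svd_decreasing[OF svd'])
  then have "rev (diag_mat Sg) = rev ss"
    using sorted_sort_id[OF is_svd_decreasing[OF svd]] by simp
  then show "ss = diag_mat Sg" by simp
qed

text \<open>The two factorisations give \<open>M\<close> and \<open>P\<close> the same column space.
  The columns of \<open>P\<close> are independent, since \<open>mat_adjoint P\<close> is a left
  inverse.\<close>

lemma rank_eq_card_orthonormal:
  assumes u: "orthonormal n p u" and P: "P = cols_mat n p u"
    and M: "M \<in> carrier_mat n m" 
    and MX: "M = P * X" "X \<in> carrier_mat p m" and PY: "P = M * Y" "Y \<in> carrier_mat m p"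
  shows "vec_space.rank n M = p"
proof -
  interpret vec_space "TYPE(complex)" n .
  have Pc: "P \<in> carrier_mat n p" by (simp add: P)
  have PP: "mat_adjoint P * P = 1\<^sub>m p" unfolding P by (rule orthonormal_cols_mat[OF u])
  have MP: "\<exists>y\<in>carrier_vec p. P *\<^sub>v y = M *\<^sub>v x" if x: "x \<in> carrier_vec m" for x
    using assoc_mult_mat_vec[OF Pc MX(2) x] mult_mat_vec_carrier[OF MX(2) x] MX(1) by metis
  have PM: "\<exists>x\<in>carrier_vec m. M *\<^sub>v x = P *\<^sub>v y" if y: "y \<in> carrier_vec p" for y
    using assoc_mult_mat_vec[OF M PY(2) y] mult_mat_vec_carrier[OF PY(2) y] PY(1) by metis
  have dims: "dim_row M = n" "dim_col M = m" "dim_row P = n" "dim_col P = p" using M Pc by auto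
  have "col_space M = col_space P"
    unfolding col_space_eq[OF M] col_space_eq[OF Pc] dims using MP PM by blast
  then have "rank M = rank P" by (simp add: rank_def col_space_def)
  moreover have "distinct (cols P)"
    unfolding distinct_conv_nth
  proof (intro allI impI)
    fix i j assume ij: "i < length (cols P)" "j < length (cols P)" "i \<noteq> j"
    then have ij': "i < p" "j < p" using Pc by auto
    have "u i \<noteq> u j" using orthonormal_inner[OF u ij'] orthonormal_inner[OF u ij'(1,1)] ij(3) by auto
    then show "cols P ! i \<noteq> cols P ! j"
      using ij ij' by (simp add: P col_cols_mat orthonormal_carrier[OF u])
  qed
  moreover have "lin_indpt (set (cols P))"
  proof
    assume "lin_dep (set (cols P))"
    then obtain v where v: "v \<in> carrier_vec p" "v \<noteq> 0\<^sub>v p" "P *\<^sub>v v = 0\<^sub>v n"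
      using lin_depE[OF Pc _ \<open>distinct (cols P)\<close>] by blast
    have "v = mat_adjoint P *\<^sub>v (P *\<^sub>v v)"
      using assoc_mult_mat_vec[OF mat_adjoint_carrier[OF Pc] Pc v(1)] PP v(1) by simp
    also have "\<dots> = 0\<^sub>v p" using v(3) Pc by (intro eq_vecI) auto
    finally show False using v(2) by simp
  qed
  ultimately show ?thesis using lin_indpt_full_rank[OF Pc] by simp
qed

section \<open>The canonical form of an idempotent\<close>

text \<open>Trades a strict bound on eigenvalues for a bound on indices. The thresholds 0 and 1
  produce the numbers \<open>p\<close> and \<open>q\<close> of the canonical basis.\<close>

lemma decreasing_threshold:
  fixes l :: "nat \<Rightarrow> real"
  assumes "\<And>i j. i \<le> j \<Longrightarrow> j < n \<Longrightarrow> l j \<le> l i"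
  obtains p where "p \<le> n" "\<And>i. i < n \<Longrightarrow> x < l i \<longleftrightarrow> i < p"
proof -
  have "\<exists>p\<le>n. \<forall>i<n. x < l i \<longleftrightarrow> i < p"
    using assms
  proof (induction n)
    case (Suc n)
    then obtain p where p: "p \<le> n" "\<forall>i<n. x < l i \<longleftrightarrow> i < p"
      by (metis less_Suc_eq)
    show ?case
    proof (cases "x < l n")
      case True
      then have "x < l i" if "i \<le> n" for i using Suc.prems[OF that] by simp
      then show ?thesis by (intro exI[of _ "Suc n"]) auto
    next
      case False
      then show ?thesis using p by (intro exI[of _ p]) (auto simp: less_Suc_eq)
    qed
  qed auto
  then show ?thesis using that by blast
qed

text \<open>The vectors \<open>w i\<close>, \<open>i < p\<close>, are eigenvectors of \<open>M M\<^sup>H\<close>. For \<open>i < q\<close> the vectors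
  \<open>w (n - q + i)\<close> are the normalised components \<open>M\<^sup>H w i - w i\<close> of \<open>M\<^sup>H w i\<close> orthogonal to
  the range of \<open>M\<close>.\<close>

proposition idempotent_canonical_basis:
  fixes M :: "complex mat"
  assumes M: "M \<in> carrier_mat n n" and idem: "M * M = M"
  obtains w l p q where "orthonormal n n w" "q \<le> p" "p + q \<le> n"
    "\<And>i. i < p \<Longrightarrow> M *\<^sub>v w i = w i"
    "\<And>i. p \<le> i \<Longrightarrow> i < n - q \<Longrightarrow> M *\<^sub>v w i = 0\<^sub>v n"
    "\<And>i. i < q \<Longrightarrow> M *\<^sub>v w (n - q + i) = complex_of_real (l i) \<cdot>\<^sub>v w i"
    "\<And>i. i < q \<Longrightarrow> 0 < l i"
    "\<And>i j. i \<le> j \<Longrightarrow> j < q \<Longrightarrow> l j \<le> l i"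
proof -
  define H where "H = mat_adjoint M"
  have H: "H \<in> carrier_mat n n" using M by (simp add: H_def)
  have HM: "mat_adjoint H = M" by (simp add: H_def)
  have "M * H \<in> carrier_mat n n" "mat_adjoint (M * H) = M * H"
    using M H by (simp_all add: mat_adjoint_mult[of _ n n _ n] HM) (simp add: H_def)
  then obtain u lam where u: "orthonormal n n u"
    and ev: "\<And>i. i < n \<Longrightarrow> (M * H) *\<^sub>v u i = complex_of_real (lam i) \<cdot>\<^sub>v u i"
    and dec: "\<And>i j. i \<le> j \<Longrightarrow> j < n \<Longrightarrow> lam j \<le> lam i"
    by (rule hermitian_eigenbasis) blast
  have uc: "u i \<in> carrier_vec n" if "i < n" for i
    using orthonormal_carrier[OF u that] .
  have Huc: "H *\<^sub>v u i \<in> carrier_vec n" if "i < n" for i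
    using mult_mat_vec_carrier[OF H uc[OF that]] .
  have MHu: "M *\<^sub>v (H *\<^sub>v u i) = complex_of_real (lam i) \<cdot>\<^sub>v u i" if "i < n" for i
    using ev[OF that] assoc_mult_mat_vec[OF M H uc[OF that]] by simp
  have HuHu: "(H *\<^sub>v u i) \<bullet>c (H *\<^sub>v u j) = (if i = j then complex_of_real (lam i) else 0)"
    if "i < n" "j < n" for i j
    using mult_mat_vec_inner[OF H uc[OF that(1)] Huc[OF that(2)]] that
    by (auto simp: HM MHu inner_smult_right[of _ n] uc orthonormal_inner[OF u])
  have lam_nonneg: "0 \<le> lam i" if "i < n" for i
  proof -
    have "complex_of_real (lam i) = complex_of_real (\<Sum>k<dim_vec (H *\<^sub>v u i). (cmod ((H *\<^sub>v u i) $ k))\<^sup>2)"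
      using HuHu[OF that that] inner_self[of "H *\<^sub>v u i"] by simp
    then show ?thesis by (simp only: of_real_eq_iff) (auto intro: sum_nonneg)
  qed
  have Hu0: "H *\<^sub>v u i = 0\<^sub>v n" if "i < n" "lam i = 0" for i
    using HuHu[OF that(1) that(1)] conjugate_square_eq_0_vec[OF Huc[OF that(1)]] that by simp
  \<comment> \<open>For nonzero \<open>lam i\<close> the vector \<open>u i\<close> is a multiple of
    \<open>M *\<^sub>v (H *\<^sub>v u i)\<close>, hence in the range of \<open>M\<close>, where an
    idempotent acts as the identity.\<close>
  have Mu: "M *\<^sub>v u i = u i" if i: "i < n" and nz: "lam i \<noteq> 0" for i
  proof -
    have "complex_of_real (lam i) \<cdot>\<^sub>v (M *\<^sub>v u i) = M *\<^sub>v (M *\<^sub>v (H *\<^sub>v u i))"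
      using mult_mat_vec[OF M uc[OF i]] MHu[OF i] by simp
    also have "\<dots> = complex_of_real (lam i) \<cdot>\<^sub>v u i"
      using assoc_mult_mat_vec[OF M M Huc[OF i]] idem MHu[OF i] by simp
    finally have "inverse (complex_of_real (lam i)) \<cdot>\<^sub>v (complex_of_real (lam i) \<cdot>\<^sub>v (M *\<^sub>v u i))
        = inverse (complex_of_real (lam i)) \<cdot>\<^sub>v (complex_of_real (lam i) \<cdot>\<^sub>v u i)" by simp
    then show ?thesis using nz by (simp add: smult_smult_assoc)
  qed
  have Hu_u: "(H *\<^sub>v u j) \<bullet>c u i = (if i = j then 1 else 0)"
    if "i < n" "j < n" "lam i \<noteq> 0" for i j
    using mult_mat_vec_inner[OF H uc[OF that(2)] uc[OF that(1)]] that
    by (auto simp: HM Mu orthonormal_inner[OF u])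
  define g where "g = (\<lambda>i. H *\<^sub>v u i - u i)"
  have gc: "g i \<in> carrier_vec n" if "i < n" for i
    using uc[OF that] Huc[OF that] by (simp add: g_def)
  have g_u: "g j \<bullet>c u i = 0" if "i < n" "j < n" "lam i \<noteq> 0" for i j
    using that Hu_u[OF that] orthonormal_inner[OF u]
    by (auto simp: g_def inner_diff_left[of _ n] uc Huc)
  have u_Hu: "u i \<bullet>c (H *\<^sub>v u j) = (if i = j then 1 else 0)"
    if "i < n" "j < n" "lam i \<noteq> 0" for i j
    using inner_swap[OF Huc[OF that(2)] uc[OF that(1)]] Hu_u[OF that] by simp
  have g_g: "g i \<bullet>c g j = (if i = j then complex_of_real (lam i - 1) else 0)"
    if "i < n" "j < n" "lam i \<noteq> 0" "lam j \<noteq> 0" for i j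
  proof -
    have "g i \<bullet>c g j = g i \<bullet>c (H *\<^sub>v u j) - g i \<bullet>c u j"
      unfolding g_def[of] using that
      by (subst inner_diff_right[of _ n]) (auto simp: uc Huc intro: minus_carrier_vec)
    also have "\<dots> = g i \<bullet>c (H *\<^sub>v u j)" using g_u that by simp
    also have "\<dots> = (H *\<^sub>v u i) \<bullet>c (H *\<^sub>v u j) - u i \<bullet>c (H *\<^sub>v u j)"
      unfolding g_def using that by (simp add: inner_diff_left[of _ n] uc Huc)
    finally show ?thesis using that HuHu u_Hu by auto
  qed
  have lam_ge: "1 \<le> lam i" if "i < n" "lam i \<noteq> 0" for i
  proof -
    have "complex_of_real (lam i - 1) = complex_of_real (\<Sum>k<dim_vec (g i). (cmod (g i $ k))\<^sup>2)"
      using g_g[OF that(1,1) that(2,2)] inner_self[of "g i"] by simp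
    then have "lam i - 1 = (\<Sum>k<dim_vec (g i). (cmod (g i $ k))\<^sup>2)" by (simp only: of_real_eq_iff)
    moreover have "0 \<le> (\<Sum>k<dim_vec (g i). (cmod (g i $ k))\<^sup>2)" by (rule sum_nonneg) simp
    ultimately show ?thesis by simp
  qed
  have g0: "g i = 0\<^sub>v n" if "i < n" "lam i = 1" for i
    using g_g[of i i] conjugate_square_eq_0_vec[OF gc[OF that(1)]] that by simp
  have Mg: "M *\<^sub>v g i = complex_of_real (lam i - 1) \<cdot>\<^sub>v u i" if "i < n" "lam i \<noteq> 0" for i
    using mult_minus_distrib_mat_vec[OF M Huc[OF that(1)] uc[OF that(1)]] that uc[OF that(1)]
    by (auto simp: g_def MHu Mu left_diff_distrib intro!: eq_vecI)
  obtain p where p: "p \<le> n" "\<And>i. i < n \<Longrightarrow> 0 < lam i \<longleftrightarrow> i < p"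
    using decreasing_threshold[of n lam 0] dec by blast
  obtain q where q: "q \<le> n" "\<And>i. i < n \<Longrightarrow> 1 < lam i \<longleftrightarrow> i < q"
    using decreasing_threshold[of n lam 1] dec by blast
  have "q \<le> p"
  proof (rule ccontr)
    assume "\<not> q \<le> p"
    then have "p < q" "p < n" using q(1) by auto
    then show False using q(2)[of p] p(2)[of p] by simp
  qed
  have lam_p: "lam i \<noteq> 0" if "i < p" for i using p(2)[of i] p(1) that by simp
  have lam_q: "lam i > 1" if "i < q" for i using q(2)[of i] q(1) that by simp
  \<comment> \<open>For \<open>i < q\<close> this is the norm of \<open>g i\<close>. It is also tan
    \<psi>, because \<open>lam i\<close> is the squared singular value 1 / cos^2 \<psi>.\<close>
  define l where "l = (\<lambda>i. sqrt (lam i - 1))"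
  have l_pos: "0 < l i" if "i < q" for i using lam_q[OF that] by (simp add: l_def)
  have l_sq: "l i * l i = lam i - 1" if "i < q" for i using lam_q[OF that] by (simp add: l_def)
  define v where "v = (\<lambda>i. complex_of_real (1 / l i) \<cdot>\<^sub>v g i)"
  have vc: "v i \<in> carrier_vec n" if "i < n" for i using gc[OF that] by (simp add: v_def)
  have gv: "g i = complex_of_real (l i) \<cdot>\<^sub>v v i" if "i < q" for i
    using l_pos[OF that] by (simp add: v_def smult_smult_assoc)
  have v_u: "v i \<bullet>c u j = 0" if "i < q" "j < p" for i j
    using that p(1) q(1) g_u[of j i] lam_p[of j] by (simp add: v_def inner_smult_left[of _ n] gc uc)
  have u_v: "u j \<bullet>c v i = 0" if "i < q" "j < p" for i j
    using v_u[OF that] inner_swap[of "v i" n "u j"] that p(1) q(1) by (simp add: vc uc)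
  have v_v: "v i \<bullet>c v j = (if i = j then 1 else 0)" if "i < q" "j < q" for i j
  proof -
    have "v i \<bullet>c v j = complex_of_real (1 / l i) * (complex_of_real (1 / l j) * (g i \<bullet>c g j))"
      using that q(1) by (simp add: v_def inner_smult_left[of _ n] inner_smult_right[of _ n] gc)
    also have "g i \<bullet>c g j = (if i = j then complex_of_real (lam i - 1) else 0)"
      using that q(1) lam_p \<open>q \<le> p\<close> by (intro g_g) auto
    also have "complex_of_real (1 / l i) * (complex_of_real (1 / l j) * \<dots>)
      = (if i = j then complex_of_real (1 / l i * (1 / l i * (lam i - 1))) else 0)"
      by simp
    also have "1 / l i * (1 / l i * (lam i - 1)) = 1"
      using l_pos[OF that(1)] by (simp add: l_sq[OF that(1), symmetric])
    finally show ?thesis by simp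
  qed
  have on: "orthonormal n (p + q) (\<lambda>i. if i < p then u i else v (i - p))"
    unfolding orthonormal_def using p(1) q(1) v_u u_v v_v 
    by (auto simp: uc vc orthonormal_inner[OF u])
  then obtain y where y: "orthonormal n n y"
    and yu: "\<And>i. i < p + q \<Longrightarrow> y i = (if i < p then u i else v (i - p))"
    by (rule orthonormal_extend) blast
  \<comment> \<open>This is the source of the bound \<open>t \<le> s\<close>: the vectors
    \<open>u i\<close> and \<open>v i\<close> together must fit into dimension
    \<open>n\<close>.\<close>
  have pq: "p + q \<le> n" by (rule orthonormal_le[OF on])
  \<comment> \<open>Moving \<open>M\<close> across the scalar product leaves \<open>y i\<close>
    against \<open>H *\<^sub>v u j\<close>. For \<open>j < p\<close> the latter is
    \<open>u j + g j\<close>, and \<open>g j\<close> is a multiple of \<open>v j\<close> or zero, so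
    both parts are orthogonal to \<open>y i\<close>; for the other \<open>j\<close> it is
    zero.\<close>
  have My: "M *\<^sub>v y i = 0\<^sub>v n" if i: "p + q \<le> i" "i < n" for i
  proof (rule orthonormal_basis_vec_eqI[OF u])
    have yi: "y i \<in> carrier_vec n" using orthonormal_carrier[OF y i(2)] .
    then show "M *\<^sub>v y i \<in> carrier_vec n" using M by simp
    have y_u: "y i \<bullet>c u j = 0" if "j < p" for j
      using orthonormal_inner[OF y i(2), of j] yu[of j] i that by simp
    have y_v: "y i \<bullet>c v j = 0" if "j < q" for j
      using orthonormal_inner[OF y i(2), of "p + j"] yu[of "p + j"] i that by simp
    fix j assume j: "j < n"
    have "(M *\<^sub>v y i) \<bullet>c u j = y i \<bullet>c (H *\<^sub>v u j)"
      unfolding H_def by (rule mult_mat_vec_inner[OF M yi uc[OF j]])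
    also have "\<dots> = 0"
    proof (cases "j < p")
      case True
      have "y i \<bullet>c g j = 0"
      proof (cases "j < q")
        case True
        then show ?thesis using gv y_v vc[OF j] yi by (simp add: inner_smult_right[of _ n])
      next
        case False
        then have "lam j = 1" using q(2)[OF j] lam_ge[OF j] lam_p[OF \<open>j < p\<close>] by simp
        then show ?thesis using g0[OF j] yi by simp
      qed
      then show ?thesis
        using y_u[OF True] inner_diff_right[OF Huc[OF j] uc[OF j] yi] by (simp add: g_def)
    next
      case False
      then have "lam j = 0" using p(2)[OF j] lam_nonneg[OF j] by simp
      then show ?thesis using Hu0[OF j] yi by simp
    qed
    finally show "(M *\<^sub>v y i) \<bullet>c u j = 0\<^sub>v n \<bullet>c u j" using uc[OF j] by simp
  qed simp
  \<comment> \<open>The extension \<open>y\<close> lists the \<open>u i\<close>, then the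
    \<open>v i\<close>, then the kernel vectors. The permutation \<open>f\<close> moves the
    \<open>v i\<close> to the last \<open>q\<close> places.\<close>
  define f where "f = (\<lambda>i. if i < p then i else if i < n - q then i + q else p + (i - (n - q)))"
  have "orthonormal n n (y \<circ> f)"
    using pq by (intro orthonormal_reindex[OF y]) (auto simp: f_def inj_on_def split: if_splits)
  moreover have "M *\<^sub>v (y \<circ> f) i = (y \<circ> f) i" if "i < p" for i
    using that yu[of i] Mu[of i] lam_p[OF that] p(1) by (simp add: f_def)
  moreover have "M *\<^sub>v (y \<circ> f) i = 0\<^sub>v n" if "p \<le> i" "i < n - q" for i
    using that My[of "i + q"] by (simp add: f_def)
  moreover have "M *\<^sub>v (y \<circ> f) (n - q + i) = complex_of_real (l i) \<cdot>\<^sub>v (y \<circ> f) i" if i: "i < q" for i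
  proof -
    have i': "i < n" "i < p" using i q(1) \<open>q \<le> p\<close> by auto
    have "(y \<circ> f) (n - q + i) = v i" "(y \<circ> f) i = u i"
      using i i' pq yu[of "p + i"] yu[of i] by (auto simp: f_def)
    moreover have "M *\<^sub>v v i = complex_of_real (1 / l i) \<cdot>\<^sub>v (complex_of_real (lam i - 1) \<cdot>\<^sub>v u i)"
      unfolding v_def using mult_mat_vec[OF M gc[OF i'(1)]] Mg[OF i'(1) lam_p[OF i'(2)]] by simp
    moreover have "complex_of_real (1 / l i) * complex_of_real (lam i - 1) = complex_of_real (l i)"
      using l_pos[OF i] by (simp only: l_sq[OF i, symmetric] of_real_mult[symmetric]) simp
    ultimately show ?thesis by (simp add: smult_smult_assoc)
  qed
  moreover have "l j \<le> l i" if "i \<le> j" "j < q" for i j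
    using dec[of i j] that q(1) by (simp add: l_def)
  ultimately show ?thesis using \<open>q \<le> p\<close> pq l_pos by (intro that[of "y \<circ> f" q p l]) auto
qed

section \<open>The orthogonal factor and the singular value decomposition\<close>

text \<open>Scalar product of two rows with at most two nonzero positions each. The positions of one
  row may coincide, in which case its two entries add.\<close>

lemma sum_two_point:
  fixes a b a' b' :: "'a :: comm_ring_1" and i i' j j' n :: nat
  assumes "i < n" "i' < n" "j < n" "j' < n"
  shows "(\<Sum>k<n. ((if k = i then a else 0) + (if k = i' then b else 0))
                * ((if k = j then a' else 0) + (if k = j' then b' else 0)))
    = (if i = j then a * a' else 0) + (if i = j' then a * b' else 0)
      + (if i' = j then b * a' else 0) + (if i' = j' then b * b' else 0)"
proof -
  have point: "(\<Sum>k<n. (if k = x then y else 0) * (if k = x' then y' else 0))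
      = (if x = x' then y * y' else 0)" if "x < n" for x x' :: nat and y y' :: 'a
  proof -
    have "(\<Sum>k<n. (if k = x then y else 0) * (if k = x' then y' else 0))
        = (\<Sum>k<n. if k = x then if x = x' then y * y' else 0 else 0)"
      by (rule sum.cong) auto
    then show ?thesis using that by simp
  qed
  show ?thesis
    by (simp only: distrib_left distrib_right sum.distrib point[OF assms(1)] point[OF assms(2)] add_ac)
qed

text \<open>For \<open>2 * t \<le> n\<close> this is the involution of the indices below
  \<open>n\<close> that exchanges the first and the last \<open>t\<close> of them and fixes the
  middle. With all signs 1, the matrix built from it acts as a reflection on each plane of exchanged
  coordinates.\<close>

definition reflection_partner :: "nat \<Rightarrow> nat \<Rightarrow> nat \<Rightarrow> nat" where
  "reflection_partner n t i = (if i < t then n - t + i else if i < n - t then i else i - (n - t))"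

definition reflection_diag ::
  "nat \<Rightarrow> nat \<Rightarrow> (nat \<Rightarrow> real) \<Rightarrow> (nat \<Rightarrow> real) \<Rightarrow> nat \<Rightarrow> real" where
  "reflection_diag n t c e i =
     (if i < t then c i else if i < n - t then 1 else - (e (i - (n - t)) * c (i - (n - t))))"

definition reflection_off ::
  "nat \<Rightarrow> nat \<Rightarrow> (nat \<Rightarrow> real) \<Rightarrow> (nat \<Rightarrow> real) \<Rightarrow> nat \<Rightarrow> real" where
  "reflection_off n t s e i =
     (if i < t then e i * s i else if i < n - t then 0 else s (i - (n - t)))"

text \<open>Off the diagonal, row \<open>i\<close> of the matrix \<open>O\<close> is supported in the column
  \<open>reflection_partner n t i\<close>; in the middle block the two positions coincide and the second
  summand vanishes.\<close>

definition reflection_mat ::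
  "nat \<Rightarrow> nat \<Rightarrow> (nat \<Rightarrow> real) \<Rightarrow> (nat \<Rightarrow> real) \<Rightarrow> (nat \<Rightarrow> real) \<Rightarrow> real mat" where
  "reflection_mat n t c s e = mat n n (\<lambda>(i, j).
     (if j = i then reflection_diag n t c e i else 0) +
     (if j = reflection_partner n t i then reflection_off n t s e i else 0))"

lemma reflection_mat_carrier [simp]: "reflection_mat n t c s e \<in> carrier_mat n n"
  by (simp add: reflection_mat_def)

text \<open>With \<open>n\<close> written as \<open>t + k + t\<close> and indices as offsets, the
  entrywise checks below are rid of most truncated subtractions.\<close>

lemma three_block_index_cases:
  fixes i t k :: nat
  assumes "i < t + k + t"
  obtains "i < t" | i' where "i = t + i'" "i' < k" | i' where "i = t + k + i'" "i' < t"
proof -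
  consider "i < t" | "t \<le> i" "i < t + k" | "t + k \<le> i" by linarith
  then show ?thesis
  proof cases
    case 2
    then show ?thesis using that(2)[of "i - t"] by simp
  next
    case 3
    then show ?thesis using that(3)[of "i - (t + k)"] assms by simp
  qed (use that in blast)
qed

text \<open>Passes from the block form of the theorem to the entrywise form, to which
  \<open>sum_two_point\<close> applies. All blocks are diagonal, so comparing the nine index cases
  suffices.\<close>

lemma nine_block_reflection_mat:
  assumes t: "2 * t \<le> n" and E: "sign_matrix t E"
    and C: "C = mat_diag t c" and S: "S = mat_diag t s"
  shows "nine_block_mat
       C                     (0\<^sub>m t (n - 2 * t))   (E * S)
       (0\<^sub>m (n - 2 * t) t)   (1\<^sub>m (n - 2 * t))     (0\<^sub>m (n - 2 * t) t)
       S                     (0\<^sub>m t (n - 2 * t))   (- (E * C))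
     = reflection_mat n t c s (\<lambda>i. E $$ (i, i))"
    (is "?N = ?Q")
proof -
  have E': "E = mat_diag t (\<lambda>i. E $$ (i, i))"
    using E by (intro eq_matI) (auto simp: sign_matrix_def mat_diag_def diagonal_mat_def)
  have ES: "E * S = mat_diag t (\<lambda>i. E $$ (i, i) * s i)"
    unfolding S by (subst E') simp
  have EC: "E * C = mat_diag t (\<lambda>i. E $$ (i, i) * c i)"
    unfolding C by (subst E') simp
  define k where "k = n - 2 * t"
  have n: "n = t + k + t" using t by (simp add: k_def)
  note defs = nine_block_mat_def append_cols_def append_rows_def reflection_mat_def
    reflection_partner_def reflection_diag_def reflection_off_def mat_diag_def
  show ?thesis
    unfolding ES EC unfolding C S k_def[symmetric] n
  proof (rule eq_matI, goal_cases)
    case (1 i j)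
    then have i: "i < t + k + t" and j: "j < t + k + t" by (auto simp: reflection_mat_def)
    show ?case
      by (rule three_block_index_cases[OF i]; rule three_block_index_cases[OF j]) (simp_all add: defs)
  qed (auto simp: defs)
qed

text \<open>Only a row and its partner overlap. Their product is
  \<open>c * s - e * e * s * c\<close>, which is zero, and each has squared norm 1; the signs enter
  through their squares alone. Squareness turns the right inverse into a two-sided one.\<close>

lemma reflection_mat_orthogonal:
  assumes t: "2 * t \<le> n" and cs: "\<And>i. i < t \<Longrightarrow> c i * c i + s i * s i = 1"
    and e: "\<And>i. i < t \<Longrightarrow> e i = 1 \<or> e i = -1"
  shows "real_orthogonal_matrix n (reflection_mat n t c s e)"
proof -
  let ?Q = "reflection_mat n t c s e"
  define k where "k = n - 2 * t"
  have n: "n = t + k + t" using t by (simp add: k_def)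
  have p: "reflection_partner n t i < n" if "i < n" for i
    using that t by (auto simp: reflection_partner_def)
  have "?Q * transpose_mat ?Q = 1\<^sub>m n"
  proof (rule eq_matI)
    fix i j assume "i < dim_row (1\<^sub>m n :: real mat)" "j < dim_col (1\<^sub>m n :: real mat)"
    then have ij: "i < n" "j < n" by auto
    then have i: "i < t + k + t" and j: "j < t + k + t" using n by auto
    let ?d = "reflection_diag n t c e" and ?o = "reflection_off n t s e"
      and ?p = "reflection_partner n t"
    have "(?Q * transpose_mat ?Q) $$ (i, j) = (\<Sum>l<n. ?Q $$ (i, l) * ?Q $$ (j, l))"
      using ij by (simp add: reflection_mat_def scalar_prod_def atLeast0LessThan)
    also have "\<dots> = (\<Sum>l<n. ((if l = i then ?d i else 0) + (if l = ?p i then ?o i else 0))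
        * ((if l = j then ?d j else 0) + (if l = ?p j then ?o j else 0)))"
      using ij by (intro sum.cong) (auto simp: reflection_mat_def)
    also have "\<dots> = (if i = j then ?d i * ?d j else 0) + (if i = ?p j then ?d i * ?o j else 0)
      + (if ?p i = j then ?o i * ?d j else 0) + (if ?p i = ?p j then ?o i * ?o j else 0)"
      by (rule sum_two_point) (use ij p in auto)
    also have "\<dots> = (if i = j then 1 else 0)"
    proof -
      note defs = reflection_partner_def reflection_diag_def reflection_off_def n
      have sc: "s m * s m + c m * c m = 1" if "m < t" for m using cs[OF that] by simp
      have e1: "e m * x * (e m * y) = x * y" if "m < t" for m x y using e[OF that] by auto
      have e2: "e m * x * - (e m * y) = - (x * y)" "- (e m * x) * (e m * y) = - (x * y)"
        if "m < t" for m x y using e[OF that] by auto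
      show ?thesis
        by (rule three_block_index_cases[OF i]; rule three_block_index_cases[OF j])
          (auto simp: defs cs sc e1 e2)
    qed
    finally show "(?Q * transpose_mat ?Q) $$ (i, j) = 1\<^sub>m n $$ (i, j)" using ij by simp
  qed (auto simp: reflection_mat_def)
  then show ?thesis
    using mat_mult_left_right_inverse[of ?Q n "transpose_mat ?Q"]
    by (simp add: real_orthogonal_matrix_def)
qed

text \<open>\<open>mat_inverse\<close> returns an option. The nonzero diagonal makes
  \<open>C\<close> a unit, which excludes \<open>None\<close>, and uniqueness of inverses identifies
  the matrix returned.\<close>

lemma singular_block_mat:
  assumes "C = mat_diag t c" "\<And>i. i < t \<Longrightarrow> c i \<noteq> 0" "t \<le> r" "t \<le> n - r" "r \<le> n"
  shows "diag_block_mat [the (mat_inverse C), 1\<^sub>m (r - t), 0\<^sub>m (n - r - t) (n - r - t), 0\<^sub>m t t]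
    = mat_diag n (\<lambda>i. if i < t then inverse (c i) else if i < r then 1 else 0 :: 'a :: field)"
proof -
  let ?B = "mat_diag t (\<lambda>i. inverse (c i))"
  have C: "C \<in> carrier_mat t t" by (simp add: assms(1))
  have CB: "C * ?B = 1\<^sub>m t"
    using assms(2) unfolding assms(1) mat_diag_diag by (auto simp: mat_diag_def intro!: eq_matI)
  have "the (mat_inverse C) = ?B"
  proof (cases "mat_inverse C")
    case None
    have "?B * C = 1\<^sub>m t" using mat_mult_left_right_inverse[OF C mat_diag_dim CB] .
    then have "C \<in> Units (ring_mat TYPE('a) t ())"
      using C CB by (auto simp: Units_def ring_mat_def intro!: bexI[of _ ?B])
    then show ?thesis using mat_inverse(1)[OF C None, of "()"] by blast
  next
    case (Some X)
    from mat_inverse(2)[OF C Some] have X: "X * C = 1\<^sub>m t" "X \<in> carrier_mat t t" by auto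
    have "X = X * (C * ?B)" using X CB by simp
    also have "\<dots> = (X * C) * ?B" by (rule assoc_mult_mat[symmetric, OF X(2) C mat_diag_dim])
    also have "\<dots> = ?B" unfolding X(1) by (rule left_mult_one_mat[OF mat_diag_dim])
    finally show ?thesis using Some by simp
  qed
  then show ?thesis
    using assms(3-) by (auto simp: mat_diag_def Let_def intro!: eq_matI)
qed

section \<open>Assembling the decomposition\<close>

lemma cmat_mult:
  "A \<in> carrier_mat n m \<Longrightarrow> B \<in> carrier_mat m k \<Longrightarrow> cmat (A * B) = cmat A * cmat B"
  by (rule of_real_hom.mat_hom_mult)

lemma unitary_matrix_mult_orthogonal:
  assumes U: "unitary_matrix n U" and Q: "real_orthogonal_matrix n Q"
  shows "unitary_matrix n (U * cmat Q)"
proof -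
  note U' = unitary_matrixD[OF U]
  have Q': "Q \<in> carrier_mat n n" "transpose_mat Q * Q = 1\<^sub>m n" 
    using Q by (auto simp: real_orthogonal_matrix_def)
  have cQ: "cmat Q \<in> carrier_mat n n" "cmat (transpose_mat Q) \<in> carrier_mat n n" using Q' by auto
  have QQ: "cmat (transpose_mat Q) * cmat Q = 1\<^sub>m n"
    using Q' cmat_mult[of "transpose_mat Q" n n Q n] of_real_hom.mat_hom_one
    by (metis transpose_carrier_mat)
  have UUx: "mat_adjoint U * (U * X) = X" if "X \<in> carrier_mat n n" for X
    using assoc_mult_mat[OF U'(2,1) that] U' that by simp
  have adj: "mat_adjoint (U * cmat Q) = cmat (transpose_mat Q) * mat_adjoint U"
    using mat_adjoint_mult[OF U'(1) cQ(1)] by (simp add: mat_adjoint_cmat)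
  have "mat_adjoint (U * cmat Q) * (U * cmat Q) = cmat (transpose_mat Q) * (mat_adjoint U * (U * cmat Q))"
    unfolding adj by (rule assoc_mult_mat[OF cQ(2) U'(2) mult_carrier_mat[OF U'(1) cQ(1)]])
  also have "\<dots> = 1\<^sub>m n" by (simp only: UUx[OF cQ(1)] QQ)
  finally have 1: "mat_adjoint (U * cmat Q) * (U * cmat Q) = 1\<^sub>m n" .
  have V: "U * cmat Q \<in> carrier_mat n n" by (rule mult_carrier_mat[OF U'(1) cQ(1)])
  show ?thesis
    unfolding unitary_matrix_def
    using V 1 mat_mult_left_right_inverse[OF mat_adjoint_carrier[OF V] V 1] by simp
qed

text \<open>Row \<open>i\<close> of the product is column \<open>i\<close> of the reflection matrix,
  scaled. For \<open>i < t\<close> the entries \<open>c i\<close> and \<open>s i\<close> become 1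
  and \<open>l i\<close>, and the middle columns are unit vectors. The signs sit in the last
  \<open>t\<close> columns, whose scale is 0 because \<open>r \<le> n - t\<close>.\<close>

lemma singular_mult_reflection_transpose:
  assumes t: "t \<le> r" "t \<le> n - r" "r \<le> n"
    and c: "\<And>i. i < t \<Longrightarrow> c i \<noteq> 0" and l: "\<And>i. i < t \<Longrightarrow> s i = l i * c i"
  shows "mat_diag n (\<lambda>i. if i < t then inverse (c i) else if i < r then 1 else 0)
      * transpose_mat (reflection_mat n t c s e)
    = mat n n (\<lambda>(i, j). (if j = i \<and> i < r then 1 else 0) + (if i < t \<and> j = n - t + i then l i else 0))"
    (is "?D * _ = ?N")
proof (rule eq_matI, goal_cases)
  case (1 i j)
  define k where "k = n - 2 * t"
  have n: "n = t + k + t" using t by (simp add: k_def)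
  from 1 have i: "i < t + k + t" and j: "j < t + k + t" using n by auto
  have "(?D * transpose_mat (reflection_mat n t c s e)) $$ (i, j)
      = (if i < t then inverse (c i) else if i < r then 1 else 0) * reflection_mat n t c s e $$ (j, i)"
    using 1 by (subst mat_diag_mult_left[of _ n n]) (auto simp: reflection_mat_def)
  also have "\<dots> = (if j = i \<and> i < r then 1 else 0) + (if i < t \<and> j = n - t + i then l i else 0)"
    using i j t c l unfolding n
    by (elim three_block_index_cases)
      (auto simp: reflection_mat_def reflection_partner_def reflection_diag_def reflection_off_def)
  finally show ?case using 1 by simp
qed (auto simp: reflection_mat_def mat_diag_def)

text \<open>\<open>?N\<close> is the matrix of \<open>M\<close> in the basis \<open>w\<close>. The
  identity \<open>M * ?U = ?U * cmat ?N\<close> is read off column by column from the action on the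
  basis.\<close>

lemma idempotent_canonical_form:
  fixes M :: "complex mat"
  assumes M: "M \<in> carrier_mat n n" and w: "orthonormal n n w" and qp: "q \<le> p" "p + q \<le> n"
    and Mw: "\<And>i. i < p \<Longrightarrow> M *\<^sub>v w i = w i"
      "\<And>i. p \<le> i \<Longrightarrow> i < n - q \<Longrightarrow> M *\<^sub>v w i = 0\<^sub>v n"
      "\<And>i. i < q \<Longrightarrow> M *\<^sub>v w (n - q + i) = complex_of_real (l i) \<cdot>\<^sub>v w i"
  shows "M = cols_mat n n w * cmat (mat n n (\<lambda>(i, j). (if j = i \<and> i < p then 1 else 0)
      + (if i < q \<and> j = n - q + i then l i else 0))) * mat_adjoint (cols_mat n n w)"
    (is "M = ?U * cmat ?N * _")
proof -
  note U = unitary_matrixD[OF orthonormal_unitary[OF w]]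
  have wc: "w i \<in> carrier_vec n" if "i < n" for i using orthonormal_carrier[OF w that] .
  have N: "cmat ?N \<in> carrier_mat n n" by simp
  have "M * ?U = ?U * cmat ?N"
  proof (rule eq_matI)
    fix a b assume "a < dim_row (?U * cmat ?N)" "b < dim_col (?U * cmat ?N)"
    then have a: "a < n" and b: "b < n" by (auto simp: cols_mat_def)
    have "(M * ?U) $$ (a, b) = (M *\<^sub>v col ?U b) $ a"
      using M U(1) a b by (simp add: cols_mat_def)
    also have "col ?U b = w b" using col_cols_mat[of w b n n, OF wc[OF b] b] .
    \<comment> \<open>Since \<open>p + q \<le> n\<close>, at most one summand survives. For
      \<open>b < n - q\<close> the index \<open>b - (n - q)\<close> truncates to 0, and the inner
      condition then annihilates that term.\<close>
    also have "(M *\<^sub>v w b) $ a = (\<Sum>i<n. (if i = b then if b < p then w b $ a else 0 else 0)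
        + (if i = b - (n - q) then if n - q \<le> b then complex_of_real (l i) * w i $ a else 0 else 0))"
    proof -
      consider "b < p" | "p \<le> b" "b < n - q" | "n - q \<le> b" by linarith
      then show ?thesis
      proof cases
        case 3
        then have b': "b - (n - q) < q" "n - q + (b - (n - q)) = b" "\<not> b < p" using b qp by auto
        from Mw(3)[OF b'(1)] have "M *\<^sub>v w b = complex_of_real (l (b - (n - q))) \<cdot>\<^sub>v w (b - (n - q))"
          unfolding b'(2) .
        then show ?thesis using 3 b' a b wc[of "b - (n - q)"] by simp
      qed (use Mw a b qp in \<open>simp_all\<close>)
    qed
    also have "\<dots> = (\<Sum>i<n. w i $ a * ((if b = i \<and> i < p then 1 else 0)
        + (if i < q \<and> b = n - q + i then complex_of_real (l i) else 0)))"
      using b qp by (intro sum.cong) (auto simp: algebra_simps)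
    also have "\<dots> = (?U * cmat ?N) $$ (a, b)"
      using a b by (auto simp: scalar_prod_def cols_mat_def atLeast0LessThan intro!: sum.cong)
    finally show "(M * ?U) $$ (a, b) = (?U * cmat ?N) $$ (a, b)" .
  qed (use M in \<open>auto simp: cols_mat_def\<close>)
  then have "?U * cmat ?N * mat_adjoint ?U = M * ?U * mat_adjoint ?U" by simp
  also have "\<dots> = M * (?U * mat_adjoint ?U)" by (rule assoc_mult_mat[OF M U(1,2)])
  finally show ?thesis using U(4) M by simp
qed

text \<open>The first \<open>p\<close> basis vectors span the range of \<open>M\<close>. Because
  \<open>q \<le> p\<close>, all rows of the canonical matrix from \<open>p\<close> on vanish, so
  \<open>M\<close> factors through \<open>?P\<close>; conversely \<open>M\<close> fixes the columns
  of \<open>?P\<close>.\<close>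

lemma idempotent_rank:
  fixes M :: "complex mat"
  assumes M: "M \<in> carrier_mat n n" and w: "orthonormal n n w" and qp: "q \<le> p" "p + q \<le> n"
    and Mw: "\<And>i. i < p \<Longrightarrow> M *\<^sub>v w i = w i"
      "\<And>i. p \<le> i \<Longrightarrow> i < n - q \<Longrightarrow> M *\<^sub>v w i = 0\<^sub>v n"
      "\<And>i. i < q \<Longrightarrow> M *\<^sub>v w (n - q + i) = complex_of_real (l i) \<cdot>\<^sub>v w i"
  shows "vec_space.rank n M = p"
proof (rule rank_eq_card_orthonormal[OF _ refl M])
  let ?N = "cmat (mat n n (\<lambda>(i, j). (if j = i \<and> i < p then 1 else 0)
      + (if i < q \<and> j = n - q + i then l i else 0)))"
  let ?N' = "mat p n (\<lambda>(i, j). ?N $$ (i, j))"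
  let ?U = "cols_mat n n w" and ?P = "cols_mat n p w"
  note U = unitary_matrixD[OF orthonormal_unitary[OF w]]
  show p: "orthonormal n p w" using w qp by (auto simp: orthonormal_def)
  have wc: "w i \<in> carrier_vec n" if "i < p" for i using orthonormal_carrier[OF p that] .
  have "?U * ?N = ?P * ?N'"
  proof (rule eq_matI)
    fix a b assume "a < dim_row (?P * ?N')" "b < dim_col (?P * ?N')"
    then have a: "a < n" and b: "b < n" by (auto simp: cols_mat_def)
    have "(?U * ?N) $$ (a, b) = (\<Sum>i<n. w i $ a * ?N $$ (i, b))"
      using a b by (auto simp: scalar_prod_def cols_mat_def atLeast0LessThan intro!: sum.cong)
    also have "\<dots> = (\<Sum>i<p. w i $ a * ?N $$ (i, b))"
      using b qp by (intro sum.mono_neutral_right) auto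
    also have "\<dots> = (?P * ?N') $$ (a, b)"
      using a b qp by (auto simp: scalar_prod_def cols_mat_def atLeast0LessThan intro!: sum.cong)
    finally show "(?U * ?N) $$ (a, b) = (?P * ?N') $$ (a, b)" .
  qed (auto simp: cols_mat_def)
  then have "M = ?P * ?N' * mat_adjoint ?U"
    using idempotent_canonical_form[OF M w qp Mw] by simp
  also have "\<dots> = ?P * (?N' * mat_adjoint ?U)"
    by (rule assoc_mult_mat[of _ n p _ n _ n]) (use U in auto)
  finally show "M = ?P * (?N' * mat_adjoint ?U)" .
  show "?N' * mat_adjoint ?U \<in> carrier_mat p n"
    by (rule mult_carrier_mat[of _ _ n]) (use U in auto)
  show "?P = M * ?P"
  proof (rule eq_matI)
    fix a b assume "a < dim_row (M * ?P)" "b < dim_col (M * ?P)"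
    then have a: "a < n" and b: "b < p" using M by (auto simp: cols_mat_def)
    have "(M * ?P) $$ (a, b) = (M *\<^sub>v col ?P b) $ a"
      using M a b by (simp add: cols_mat_def)
    also have "\<dots> = w b $ a" using col_cols_mat[of w b n p] wc[OF b] b Mw(1)[OF b] by simp
    finally show "?P $$ (a, b) = (M * ?P) $$ (a, b)" using a b by (simp add: cols_mat_def)
  qed (use M in \<open>auto simp: cols_mat_def\<close>)
  show "?P \<in> carrier_mat n p" by simp
qed

text \<open>The product of \<open>D\<close> with the transpose of \<open>Q\<close> is the canonical
  matrix, and the transpose together with \<open>mat_adjoint U\<close> forms the adjoint of
  \<open>U * cmat Q\<close>. The diagonal of \<open>D\<close> decreases because \<open>c\<close>
  increases and stays at most 1, so the inverses precede the ones and zeros.\<close>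

lemma canonical_svd:
  assumes U: "unitary_matrix n U" and t: "t \<le> r" "t \<le> n - r" "r \<le> n"
    and c: "\<And>i. i < t \<Longrightarrow> 0 < c i \<and> c i \<le> 1" "\<And>i j. i \<le> j \<Longrightarrow> j < t \<Longrightarrow> c i \<le> c j"
    and cs: "\<And>i. i < t \<Longrightarrow> c i * c i + s i * s i = 1" and l: "\<And>i. i < t \<Longrightarrow> s i = l i * c i"
    and e: "\<And>i. i < t \<Longrightarrow> e i = 1 \<or> e i = -1"
    and M: "M = U * cmat (mat n n (\<lambda>(i, j). (if j = i \<and> i < r then 1 else 0)
      + (if i < t \<and> j = n - t + i then l i else 0))) * mat_adjoint U"
    and D: "D = mat_diag n (\<lambda>i. if i < t then inverse (c i) else if i < r then 1 else 0)"
    and Q: "Q = reflection_mat n t c s e"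
  shows "real_orthogonal_matrix n Q \<and> unitary_matrix n (U * cmat Q)
    \<and> M = U * cmat D * cmat (transpose_mat Q) * mat_adjoint U
    \<and> M = U * cmat D * mat_adjoint (U * cmat Q)
    \<and> is_svd n M U D (U * cmat Q)"
proof -
  note U' = unitary_matrixD[OF U]
  have Qo: "real_orthogonal_matrix n Q"
    unfolding Q by (rule reflection_mat_orthogonal) (use t cs e in auto)
  have V: "unitary_matrix n (U * cmat Q)" by (rule unitary_matrix_mult_orthogonal[OF U Qo])
  have Dc: "D \<in> carrier_mat n n" and Qc: "Q \<in> carrier_mat n n" by (simp_all add: D Q)
  have cD: "cmat D \<in> carrier_mat n n" and cQ: "cmat Q \<in> carrier_mat n n" 
    and cQ': "cmat (transpose_mat Q) \<in> carrier_mat n n" using Dc Qc by auto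
  have c0: "c i \<noteq> 0" if "i < t" for i using c(1)[OF that] by simp
  have "D * transpose_mat Q = mat n n (\<lambda>(i, j). (if j = i \<and> i < r then 1 else 0)
      + (if i < t \<and> j = n - t + i then l i else 0))"
    unfolding D Q using singular_mult_reflection_transpose[of t r n c s l e] t c0 l by blast
  then have "M = U * (cmat D * cmat (transpose_mat Q)) * mat_adjoint U"
    using M cmat_mult[OF Dc, of "transpose_mat Q" n] Qc by simp
  also have "U * (cmat D * cmat (transpose_mat Q)) = U * cmat D * cmat (transpose_mat Q)"
    by (rule assoc_mult_mat[symmetric, OF U'(1) cD cQ'])
  finally have 1: "M = U * cmat D * cmat (transpose_mat Q) * mat_adjoint U" .
  also have "\<dots> = U * cmat D * (cmat (transpose_mat Q) * mat_adjoint U)"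
    by (rule assoc_mult_mat[OF mult_carrier_mat[OF U'(1) cD] cQ' U'(2)])
  also have "cmat (transpose_mat Q) * mat_adjoint U = mat_adjoint (U * cmat Q)"
    using mat_adjoint_mult[OF U'(1) cQ] by (simp add: mat_adjoint_cmat)
  finally have 2: "M = U * cmat D * mat_adjoint (U * cmat Q)" .
  have "diagonal_mat D" by (simp add: D mat_diag_def diagonal_mat_def)
  moreover have "\<forall>i<n. 0 \<le> D $$ (i, i)" using c(1) by (auto simp: D mat_diag_def less_imp_le)
  moreover have "\<forall>i j. i \<le> j \<and> j < n \<longrightarrow> D $$ (j, j) \<le> D $$ (i, i)"
    using c(1) c(2) t by (force simp: D mat_diag_def le_imp_inverse_le one_le_inverse_iff)
  ultimately have "is_svd n M U D (U * cmat Q)"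
    using U V Dc 2 by (simp add: is_svd_def)
  then show ?thesis using Qo V 1 2 by blast
qed

text \<open>Indices start at 0. The dimension bounds in the conclusion certify that no natural
  subtraction in the definitions of \<open>s\<close> and \<open>t\<close> or in the block sizes
  truncates.\<close>

theorem theorem2p3:
  fixes M :: "complex mat" and n r s t :: nat
    and \<sigma> \<psi> :: "nat \<Rightarrow> real" and C S SS :: "real mat"
  assumes "M \<in> carrier_mat n n"
    and "M * M = M"
    and "r = vec_space.rank n M"
    and "s = n - r"
    and "t = r - kernel_dim (1\<^sub>m n - M * mat_adjoint M)"
    and "\<And>j. j < r \<Longrightarrow> \<sigma> j = nonzero_singular_values n M ! j"
    and "\<And>j. j < r \<Longrightarrow> \<psi> j = arccos (inverse (\<sigma> j))"
    and "C = mat_diag t (\<lambda>j. cos (\<psi> j))"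
    and "S = mat_diag t (\<lambda>j. sin (\<psi> j))"
    and "SS = diag_block_mat
               [the (mat_inverse C), 1\<^sub>m (r - t), 0\<^sub>m (s - t) (s - t), 0\<^sub>m t t]"
  shows "r \<le> n \<and> kernel_dim (1\<^sub>m n - M * mat_adjoint M) \<le> r \<and> t \<le> min r s
    \<and> length (nonzero_singular_values n M) = r
    \<and> (\<forall>j<r. 0 \<le> \<psi> j \<and> \<psi> j < pi / 2 \<and> cos (\<psi> j) = inverse (\<sigma> j))
    \<and> (\<forall>i j. i \<le> j \<and> j < r \<longrightarrow> \<psi> j \<le> \<psi> i)
    \<and> (\<forall>j<r. 0 < \<psi> j \<longleftrightarrow> j < t)
    \<and> (\<exists>U. unitary_matrix n U \<and>
         (\<forall>E. sign_matrix t E \<longrightarrow>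
            (let Q = nine_block_mat
                       C                     (0\<^sub>m t (n - 2 * t))   (E * S)
                       (0\<^sub>m (n - 2 * t) t)   (1\<^sub>m (n - 2 * t))     (0\<^sub>m (n - 2 * t) t)
                       S                     (0\<^sub>m t (n - 2 * t))   (- (E * C));
                 V = U * cmat Q
             in real_orthogonal_matrix n Q
                \<and> unitary_matrix n V
                \<and> M = U * cmat SS * cmat (transpose_mat Q) * mat_adjoint U
                \<and> M = U * cmat SS * mat_adjoint V
                \<and> is_svd n M U SS V)))"
proof -
  note M = assms(1) and idem = assms(2)
  obtain w l p q where w: "orthonormal n n w" and qp: "q \<le> p" "p + q \<le> n"
    and Mw: "\<And>i. i < p \<Longrightarrow> M *\<^sub>v w i = w i"
      "\<And>i. p \<le> i \<Longrightarrow> i < n - q \<Longrightarrow> M *\<^sub>v w i = 0\<^sub>v n"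
      "\<And>i. i < q \<Longrightarrow> M *\<^sub>v w (n - q + i) = complex_of_real (l i) \<cdot>\<^sub>v w i"
    and l: "\<And>i. i < q \<Longrightarrow> 0 < l i" "\<And>i j. i \<le> j \<Longrightarrow> j < q \<Longrightarrow> l j \<le> l i"
    by (rule idempotent_canonical_basis[OF M idem]) blast
  define U where "U = cols_mat n n w"
  have U: "unitary_matrix n U" unfolding U_def by (rule orthonormal_unitary[OF w])
  \<comment> \<open>As \<open>l i\<close> is tan \<psi>, this is cos \<psi>, and \<open>s'\<close>
    is sin \<psi>. The identification with the given angles follows once the singular values are
    known.\<close>
  define c where "c = (\<lambda>i. 1 / sqrt (1 + (l i)\<^sup>2))"
  define s' where "s' = (\<lambda>i. l i * c i)"
  define d where "d = (\<lambda>i. if i < q then inverse (c i) else if i < p then 1 else 0)"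
  define D where "D = mat_diag n d"
  have sq: "1 < sqrt (1 + (l i)\<^sup>2)" if "i < q" for i using l(1)[OF that] by simp
  have c_bounds: "0 < c i" "c i < 1" if "i < q" for i
  proof -
    have "0 < 1 / x \<and> 1 / x < 1" if "1 < x" for x :: real using that by simp
    from this[OF sq[OF that]] show "0 < c i" "c i < 1" by (simp_all only: c_def)
  qed
  have c_mono: "c i \<le> c j" if "i \<le> j" "j < q" for i j
  proof -
    have "(l j)\<^sup>2 \<le> (l i)\<^sup>2" using l(1)[OF that(2)] l(2)[OF that] by (intro power_mono) auto
    then have "sqrt (1 + (l j)\<^sup>2) \<le> sqrt (1 + (l i)\<^sup>2)" by simp
    moreover have "0 < sqrt (1 + (l j)\<^sup>2)" using sq[OF that(2)] by linarith
    ultimately show ?thesis unfolding c_def by (intro frac_le) auto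
  qed
  have cs: "c i * c i + s' i * s' i = 1" for i
  proof -
    have pos: "0 < 1 + (l i)\<^sup>2" by (rule add_pos_nonneg) auto
    have cc: "c i * c i = 1 / (1 + (l i)\<^sup>2)" using pos by (simp add: c_def)
    have "c i * c i + s' i * s' i = (1 + (l i)\<^sup>2) * (c i * c i)"
      by (simp add: s'_def power2_eq_square algebra_simps)
    then show ?thesis using pos by (simp add: cc)
  qed
  have rank: "r = p" unfolding assms(3) by (rule idempotent_rank[OF M w qp Mw])
  have qs: "q \<le> n - p" "p \<le> n" using qp by auto
  have c_le: "0 < c i \<and> c i \<le> 1" if "i < q" for i using c_bounds[OF that] by simp
  have svd: "real_orthogonal_matrix n Q \<and> unitary_matrix n (U * cmat Q)
      \<and> M = U * cmat D * cmat (transpose_mat Q) * mat_adjoint U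
      \<and> M = U * cmat D * mat_adjoint (U * cmat Q) \<and> is_svd n M U D (U * cmat Q)"
    if "\<And>i. i < q \<Longrightarrow> e i = 1 \<or> e i = -1" "Q = reflection_mat n q c s' e" for Q e
    by (rule canonical_svd[OF U qp(1) qs c_le c_mono cs _ that(1)
          idempotent_canonical_form[OF M w qp Mw, folded U_def] _ that(2)])
      (simp_all add: s'_def D_def d_def)
  \<comment> \<open>Any signs would do here: one decomposition already determines the singular
    values and the spectrum of \<open>M * mat_adjoint M\<close>.\<close>
  have svd1: "is_svd n M U D (U * cmat (reflection_mat n q c s' (\<lambda>_. 1)))"
    using svd[of "\<lambda>_. 1", OF _ refl] by blast
  have dpos: "d i \<noteq> 0 \<longleftrightarrow> i < p" for i using c_bounds[of i] qp by (auto simp: d_def)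
  have "singular_values n M = map d [0..<n]"
    unfolding singular_values_eq[OF svd1] by (simp add: D_def diag_mat_def mat_diag_def)
  moreover have "[0..<n] = [0..<p] @ [p..<n]" using upt_add_eq_append[of 0 p "n - p"] qs(2) by simp
  ultimately have sv: "nonzero_singular_values n M = map d [0..<p]"
    using dpos by (simp add: nonzero_singular_values_def filter_map o_def filter_empty_conv)
  \<comment> \<open>The dimension is the multiplicity of the singular value 1. Entries before
    \<open>q\<close> exceed 1 and those from \<open>p\<close> on are 0, leaving the indices from
    \<open>q\<close> to \<open>p - 1\<close>; hence \<open>t = q\<close>.\<close>
  have ker: "kernel_dim (1\<^sub>m n - M * mat_adjoint M) = p - q"
  proof -
    have "1 \<cdot>\<^sub>m 1\<^sub>m n = (1\<^sub>m n :: complex mat)" by auto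
    then have "kernel_dim (1\<^sub>m n - M * mat_adjoint M)
        = card {i. i < n \<and> complex_of_real ((D $$ (i, i))\<^sup>2) = 1}"
      using kernel_dim_shift_unitary_diag[OF U is_svd_gram[OF svd1], of 1] by simp
    also have "{i. i < n \<and> complex_of_real ((D $$ (i, i))\<^sup>2) = 1} = {q..<p}"
    proof -
      have "complex_of_real ((D $$ (i, i))\<^sup>2) = 1 \<longleftrightarrow> q \<le> i \<and> i < p" if "i < n" for i
      proof -
        have "complex_of_real ((D $$ (i, i))\<^sup>2) = 1 \<longleftrightarrow> (d i)\<^sup>2 = 1"
          using that by (simp add: D_def mat_diag_def del: of_real_power)
        also have "\<dots> \<longleftrightarrow> d i = 1"
        proof -
          have "0 \<le> d i" using c_bounds[of i] by (auto simp: d_def less_imp_le)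
          then show ?thesis by (auto simp: power2_eq_1_iff)
        qed
        also have "\<dots> \<longleftrightarrow> q \<le> i \<and> i < p"
          using c_bounds[of i] qp(1) by (auto simp: d_def)
        finally show ?thesis .
      qed
      then show ?thesis using qs(2) by auto
    qed
    finally show ?thesis by simp
  qed
  have t: "t = q" using assms(5) ker rank qp(1) by simp
  have sigma: "\<sigma> j = d j" if "j < p" for j using assms(6) that sv rank by simp
  \<comment> \<open>Continues \<open>c\<close> by the value 1, the cosine of the zero angles that
    belong to the singular values equal to 1.\<close>
  define k where "k = (\<lambda>j. if j < q then c j else 1)"
  have inv: "inverse (\<sigma> j) = k j" if "j < p" for j using sigma[OF that] that by (simp add: d_def k_def)
  have psi: "\<psi> j = arccos (k j)" if "j < p" for j using assms(7) that inv rank by simp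
  have k: "0 < k j" "k j \<le> 1" for j using c_bounds[of j] by (auto simp: k_def)
  have cos_psi: "cos (\<psi> j) = k j" if "j < p" for j
    unfolding psi[OF that] by (rule cos_arccos) (use k[of j] in auto)
  have C: "C = mat_diag t c"
    unfolding assms(8) mat_diag_def
    by (rule eq_matI) (use cos_psi qp(1) in \<open>auto simp: t k_def\<close>)
  have sin_psi: "sin (\<psi> j) = s' j" if "j < q" for j
  proof -
    have "j < p" using that qp(1) by simp
    have "sin (\<psi> j) = sqrt (1 - (k j)\<^sup>2)"
      unfolding psi[OF \<open>j < p\<close>] by (rule sin_arccos) (use k[of j] in auto)
    also have "1 - (k j)\<^sup>2 = (s' j)\<^sup>2" using cs[of j] that by (simp add: k_def power2_eq_square)
    also have "sqrt \<dots> = s' j" using l(1)[OF that] c_bounds[OF that] by (simp add: s'_def)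
    finally show ?thesis .
  qed
  have S: "S = mat_diag t s'"
    unfolding assms(9) mat_diag_def by (rule eq_matI) (use sin_psi in \<open>auto simp: t\<close>)
  have SS: "SS = D"
    unfolding assms(10) D_def d_def assms(4) rank t[symmetric]
    by (rule singular_block_mat[OF C]) (use c_bounds qp qs t in \<open>force+\<close>)
  have psi_range: "0 \<le> \<psi> j \<and> \<psi> j < pi / 2 \<and> cos (\<psi> j) = inverse (\<sigma> j)" if "j < p" for j
  proof -
    have "arccos (k j) < arccos 0" using k[of j] by (intro arccos_less_arccos) auto
    moreover have "0 \<le> arccos (k j)" using k[of j] by (intro arccos_lbound) auto
    ultimately show ?thesis using cos_psi[OF that] inv[OF that] psi[OF that] by simp
  qed
  have psi_mono: "\<psi> j \<le> \<psi> i" if "i \<le> j" "j < p" for i j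
  proof -
    have "k i \<le> k j" using c_mono[of i j] c_le[of i] that by (auto simp: k_def)
    then show ?thesis using that k[of i] k[of j] psi[of i] psi[of j] by (auto intro: arccos_le_arccos)
  qed
  have psi_pos: "0 < \<psi> j \<longleftrightarrow> j < t" if "j < p" for j
  proof (cases "j < q")
    case True
    have "arccos 1 < arccos (c j)" using c_bounds[OF True] by (intro arccos_less_arccos) auto
    then show ?thesis using True psi[OF that] by (simp add: k_def t)
  qed (use psi[OF that] in \<open>simp add: k_def t\<close>)
  have main: "let Q = nine_block_mat
                       C                     (0\<^sub>m t (n - 2 * t))   (E * S)
                       (0\<^sub>m (n - 2 * t) t)   (1\<^sub>m (n - 2 * t))     (0\<^sub>m (n - 2 * t) t)
                       S                     (0\<^sub>m t (n - 2 * t))   (- (E * C));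
                 V = U * cmat Q
             in real_orthogonal_matrix n Q
                \<and> unitary_matrix n V
                \<and> M = U * cmat SS * cmat (transpose_mat Q) * mat_adjoint U
                \<and> M = U * cmat SS * mat_adjoint V
                \<and> is_svd n M U SS V" if E: "sign_matrix t E" for E
  proof -
    have t2: "2 * t \<le> n" using qp t by simp
    show ?thesis
      unfolding Let_def SS nine_block_reflection_mat[OF t2 E C S]
      by (rule svd[where e = "\<lambda>i. E $$ (i, i)"]) (use E t in \<open>auto simp: sign_matrix_def\<close>)
  qed
  show ?thesis
    using rank ker qp t assms(4) sv psi_range psi_mono psi_pos U main
    by (intro conjI exI[of _ U]) auto
qed

end
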